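(* Let $\kappa$ be a signature wavelet and let $\sigma$ denote the signature with respect to $\kappa$. Let $\{\psi_{jk}\}_{j,k\in\mathbb{Z}}$ be an orthonormal wavelet basis of $L^2(\mathbb{R})$ such that $\psi=\psi_{00}$ has compactly supported Fourier transform. Let $f\in L^2(\mathbb{R})$, $b\in\mathbb{R}$, and let $A_\varepsilon$ be the operator of random wavelet sign perturbations $$A_\varepsilon f=\sum_{j\in\mathbb{Z}}\sum_{k\in\mathbb{Z}}\varepsilon_{jk}\,\langle f,\psi_{jk}\rangle_{L^2}\,\psi_{jk},$$ where $\varepsilon=\{\varepsilon_{jk}\}_{j,k\in\mathbb{Z}}$ is a Rademacher sequence. Then $$\sigma(A_\varepsilon f)(b)=0\quad\text{for almost every }\varepsilon.$$
   Context: The Fourier transform is $\widehat f(\omega)=\int_{\mathbb{R}}e^{-i\omega x}f(x)\,dx$. A signature wavelet is a non-zero complex-valued Schwartz function $\kappa\in\mathscr{S}(\mathbb{R},\mathbb{C})$ such that $\operatorname{supp}\widehat\kappa\subseteq[c,d]$ for some $0<c<d<\infty$ and $\widehat\kappa(\omega)\ge 0$ for all $\omega\in\mathbb{R}$. For $a>0$, $b\in\mathbb{R}$ put $\kappa_{a,b}(x)=\frac{1}{\sqrt a}\,\kappa\left(\frac{x-b}{a}\right)$. The pairing $\langle f,\phi\rangle$ of a tempered distribution with a Schwartz function is bilinear (no complex conjugation), i.e. $\langle f,\phi\rangle=\int f\phi\,dx$ for functions $f$. For $z\in\mathbb{C}\setminus\{0\}$, $\operatorname{sgn} z=z/|z|$,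 and $\operatorname{sgn}0=0$. The signature of $f$ at $b$ (with respect to $\kappa$) is $\sigma f(b)=\lim_{a\to0+}\operatorname{sgn}\langle f,\kappa_{a,b}\rangle$ if this limit exists in $\mathbb{C}$, and $\sigma f(b)=0$ otherwise. Signals $f$ are real-valued. In the orthonormal wavelet basis $\psi_{jk}(x)=2^{j/2}\psi(2^jx-k)$, $j$ is the dyadic level and $k$ the translation parameter; $\langle\cdot,\cdot\rangle_{L^2}$ is the $L^2$ inner product, and the series defining $A_\varepsilon f$ converges in $L^2$-norm. A Rademacher sequence is a family of independent, identically distributed random variables taking the values $\pm1$ with probability $\frac12$ each; "almost every $\varepsilon$" refers to the associated probability measure. *)

theory Defs
  imports "HOL-Probability.Probability"
begin

section \<open>Square-integrable functions\<close>

text \<open>Elements of $L^2(\mathbb{R})$ are handled through representatives; every notion below that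
  takes such a representative is invariant under equality almost everywhere.\<close>

definition square_integrable :: "(real \<Rightarrow> complex) \<Rightarrow> bool" where
  "square_integrable f \<longleftrightarrow>
     f \<in> borel_measurable lebesgue \<and> integrable lebesgue (\<lambda>x. (cmod (f x))\<^sup>2)"

definition L2_inner :: "(real \<Rightarrow> complex) \<Rightarrow> (real \<Rightarrow> complex) \<Rightarrow> complex" where
  "L2_inner f g = (LINT x|lebesgue. f x * cnj (g x))"

definition L2_norm :: "(real \<Rightarrow> complex) \<Rightarrow> real" where
  "L2_norm f = sqrt (LINT x|lebesgue. (cmod (f x))\<^sup>2)"

text \<open>The membership conditions matter: the Bochner integral of a non-integrable function is \<open>0\<close>,
  so the limit of the norms alone would not express convergence.\<close>

definition tendsto_L2 ::
    "('i \<Rightarrow> real \<Rightarrow> complex) \<Rightarrow> (real \<Rightarrow> complex) \<Rightarrow> 'i filter \<Rightarrow> bool" where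
  "tendsto_L2 h g F \<longleftrightarrow>
     (\<forall>\<^sub>F i in F. square_integrable (h i)) \<and> square_integrable g \<and>
     ((\<lambda>i. L2_norm (\<lambda>x. h i x - g x)) \<longlongrightarrow> 0) F"

definition orthonormal_basis_L2 :: "('i \<Rightarrow> real \<Rightarrow> complex) \<Rightarrow> bool" where
  "orthonormal_basis_L2 e \<longleftrightarrow>
     (\<forall>i. square_integrable (e i)) \<and>
     (\<forall>i i'. L2_inner (e i) (e i') = (if i = i' then 1 else 0)) \<and>
     (\<forall>g. square_integrable g \<longrightarrow>
        (\<forall>\<delta>>0. \<exists>S c. finite S \<and> L2_norm (\<lambda>x. g x - (\<Sum>i\<in>S. c i * e i x)) < \<delta>))"

section \<open>Fourier transform\<close>

definition fourier :: "(real \<Rightarrow> complex) \<Rightarrow> real \<Rightarrow> complex" where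
  "fourier f \<omega> = (LINT x|lebesgue. exp (- (\<i> * complex_of_real (\<omega> * x))) * f x)"

text \<open>The Fourier--Plancherel transform of a square-integrable \<open>f\<close>, which need not be integrable
  (as for the Shannon wavelet): the $L^2$-limit of the transforms of the truncations of \<open>f\<close>.\<close>

definition has_L2_fourier :: "(real \<Rightarrow> complex) \<Rightarrow> (real \<Rightarrow> complex) \<Rightarrow> bool" where
  "has_L2_fourier f g \<longleftrightarrow>
     tendsto_L2 (\<lambda>R. fourier (\<lambda>x. indicator {-R..R} x * f x)) g at_top"

definition ess_support :: "(real \<Rightarrow> complex) \<Rightarrow> real set" where
  "ess_support g = - \<Union>{U. open U \<and> (AE x in lebesgue. x \<in> U \<longrightarrow> g x = 0)}"

section \<open>Signature wavelets and the signature\<close>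

definition schwartz :: "(real \<Rightarrow> complex) \<Rightarrow> bool" where
  "schwartz f \<longleftrightarrow>
     (\<forall>n. let f\<^sub>n = ((\<lambda>g x. vector_derivative g (at x)) ^^ n) f in
        (\<forall>x. f\<^sub>n differentiable (at x)) \<and>
        (\<forall>m::nat. \<exists>C. \<forall>x. \<bar>x\<bar> ^ m * cmod (f\<^sub>n x) \<le> C))"

definition signature_wavelet :: "(real \<Rightarrow> complex) \<Rightarrow> bool" where
  "signature_wavelet \<kappa> \<longleftrightarrow>
     schwartz \<kappa> \<and> \<kappa> \<noteq> (\<lambda>_. 0) \<and>
     (\<exists>c d. 0 < c \<and> c < d \<and> closure {\<omega>. fourier \<kappa> \<omega> \<noteq> 0} \<subseteq> {c..d}) \<and>
     (\<forall>\<omega>. fourier \<kappa> \<omega> \<in> \<real>\<^sub>\<ge>\<^sub>0)"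

definition dilate :: "(real \<Rightarrow> complex) \<Rightarrow> real \<Rightarrow> real \<Rightarrow> real \<Rightarrow> complex" where
  "dilate \<kappa> a b x = complex_of_real (1 / sqrt a) * \<kappa> ((x - b) / a)"

definition pairing :: "(real \<Rightarrow> complex) \<Rightarrow> (real \<Rightarrow> complex) \<Rightarrow> complex" where
  "pairing f \<phi> = (LINT x|lebesgue. f x * \<phi> x)"

definition signature :: "(real \<Rightarrow> complex) \<Rightarrow> (real \<Rightarrow> complex) \<Rightarrow> real \<Rightarrow> complex" where
  "signature \<kappa> f b =
     (let s = (\<lambda>a. sgn (pairing f (dilate \<kappa> a b))) in
        if \<exists>l. (s \<longlongrightarrow> l) (at_right 0) then Lim (at_right 0) s else 0)"

section \<open>Orthonormal wavelet bases and random sign perturbations\<close>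

definition wavelet :: "(real \<Rightarrow> complex) \<Rightarrow> int \<times> int \<Rightarrow> real \<Rightarrow> complex" where
  "wavelet \<psi> = (\<lambda>(j, k) x.
     complex_of_real (2 powr (real_of_int j / 2)) * \<psi> (2 powi j * x - real_of_int k))"

definition orthonormal_wavelet_basis :: "(real \<Rightarrow> complex) \<Rightarrow> bool" where
  "orthonormal_wavelet_basis \<psi> \<longleftrightarrow> orthonormal_basis_L2 (wavelet \<psi>)"

text \<open>A representative of the (unconditional) $L^2$-sum of the series; the limit is unique up to
  equality almost everywhere.\<close>

definition sign_perturbation ::
    "(real \<Rightarrow> complex) \<Rightarrow> (int \<times> int \<Rightarrow> real) \<Rightarrow> (real \<Rightarrow> complex) \<Rightarrow> (real \<Rightarrow> complex)" where
  "sign_perturbation \<psi> e f = (SOME g. tendsto_L2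
     (\<lambda>S x. \<Sum>p\<in>S. complex_of_real (e p) * L2_inner f (wavelet \<psi> p) * wavelet \<psi> p x)
     g (finite_subsets_at_top UNIV))"

definition rademacher :: "'w measure \<Rightarrow> ('i \<Rightarrow> 'w \<Rightarrow> real) \<Rightarrow> bool" where
  "rademacher M \<epsilon> \<longleftrightarrow>
     prob_space M \<and>
     prob_space.indep_vars M (\<lambda>_. borel) \<epsilon> UNIV \<and>
     (\<forall>i. measure M {w \<in> space M. \<epsilon> i w = 1} = 1 / 2 \<and>
          measure M {w \<in> space M. \<epsilon> i w = - 1} = 1 / 2)"

end

theory Submission imports Defs begin

text \<open>
  Write $X_a = \langle A_\varepsilon f, \kappa_{a,b}\rangle$. Since $\psi_{jk}$ is a dilate and
  translate of $\psi$, its Fourier transform lives in a frequency ball of radius comparable to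
  $2^j$, whereas $\kappa_{a,b}$ only sees frequencies of size at least $c/a$. Hence every fixed
  basis function eventually has zero pairing with $\kappa_{a,b}$ as $a \to 0+$
  (\<open>eventually_pairing_wavelet_dilate_eq_0\<close>), and changing finitely many of the signs
  $\varepsilon_{jk}$ does not affect $X_a$ for small $a$.

  The limit of $\operatorname{sgn} X_a$ is therefore a tail functional of the independent signs, so
  by Kolmogorov's zero-one law the event that, say, its real part is positive has probability $0$
  or $1$. But flipping all signs preserves the law of $\varepsilon$ and turns the limit into its
  negative; the events that the real part is positive and that it is negative thus have the same
  probability, and being disjoint they cannot both be certain. So the limit, where it exists, is
  $0$ almost surely (\<open>odd_tail_functional_eq_0\<close>). Measurability causes no trouble because it
  suffices to follow the limit along the sequence $a_n = 1/(n+1)$.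

  Two analytic facts make this precise. The series for $A_\varepsilon f$ converges in $L^2$
  (Bessel's inequality and completeness), so that $X_a$ is the sum of
  $\varepsilon_{jk} \langle f, \psi_{jk}\rangle \langle \psi_{jk}, \kappa_{a,b}\rangle$
  (\<open>has_sum_pairing_sign_perturbation\<close>). And the disjointness of frequency bands is turned
  into the vanishing of a pairing by Parseval's formula (\<open>Parseval_pairing\<close>), which rests on
  Fourier inversion for the smooth factor only.
\<close>

section \<open>Square-integrable functions and orthonormal series\<close>

lemma square_integrableD:
  assumes "square_integrable f"
  shows "f \<in> borel_measurable lebesgue" "integrable lebesgue (\<lambda>x. (cmod (f x))\<^sup>2)"
  using assms unfolding square_integrable_def by auto

lemma square_integrable_scale:
  assumes "square_integrable f"
  shows "square_integrable (\<lambda>x. c * f x)"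
  using assms unfolding square_integrable_def by (auto simp: norm_mult power_mult_distrib)

lemma square_integrable_cnj:
  assumes "square_integrable f"
  shows "square_integrable (\<lambda>x. cnj (f x))"
proof -
  have "cnj \<in> borel_measurable borel"
    by (intro borel_measurable_continuous_onI continuous_intros)
  from measurable_compose[OF _ this] show ?thesis
    using assms unfolding square_integrable_def by auto
qed

lemma norm_add_squared_le:
  fixes a b :: "'a :: real_normed_vector"
  shows "(norm (a + b))\<^sup>2 \<le> 2 * (norm a)\<^sup>2 + 2 * (norm b)\<^sup>2"
proof -
  have "(norm (a + b))\<^sup>2 \<le> (norm a + norm b)\<^sup>2"
    by (intro power_mono norm_triangle_ineq) auto
  also have "\<dots> \<le> 2 * (norm a)\<^sup>2 + 2 * (norm b)\<^sup>2"
    using sum_squares_bound[of "norm a" "norm b"] by (simp add: power2_sum)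
  finally show ?thesis .
qed

lemma square_integrable_add:
  assumes f: "square_integrable f" and g: "square_integrable g"
  shows "square_integrable (\<lambda>x. f x + g x)"
proof -
  note [measurable] = square_integrableD(1)[OF f] square_integrableD(1)[OF g]
  have "integrable lebesgue (\<lambda>x. (cmod (f x + g x))\<^sup>2)"
  proof (rule Bochner_Integration.integrable_bound)
    show "integrable lebesgue (\<lambda>x. 2 * (cmod (f x))\<^sup>2 + 2 * (cmod (g x))\<^sup>2)"
      using square_integrableD(2)[OF f] square_integrableD(2)[OF g] by auto
    show "AE x in lebesgue. norm ((cmod (f x + g x))\<^sup>2) \<le> norm (2 * (cmod (f x))\<^sup>2 + 2 * (cmod (g x))\<^sup>2)"
      using norm_add_squared_le by (intro AE_I2) force
  qed measurable
  then show ?thesis unfolding square_integrable_def by auto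
qed

lemma square_integrable_diff:
  assumes "square_integrable f" "square_integrable g"
  shows "square_integrable (\<lambda>x. f x - g x)"
  using square_integrable_add[OF assms(1) square_integrable_scale[OF assms(2), of "-1"]] by simp

lemma square_integrable_sum:
  assumes "\<And>i. i \<in> S \<Longrightarrow> square_integrable (e i)"
  shows "square_integrable (\<lambda>x. \<Sum>i\<in>S. e i x)"
  using assms
proof (induction S rule: infinite_finite_induct)
  case (insert i S)
  then show ?case using square_integrable_add[of "e i" "\<lambda>x. \<Sum>i\<in>S. e i x"] by simp
qed (simp_all add: square_integrable_def)

lemma square_integrable_mult_integrable:
  assumes f: "square_integrable f" and g: "square_integrable g"
  shows "integrable lebesgue (\<lambda>x. f x * g x)"
proof (rule Bochner_Integration.integrable_bound)
  note [measurable] = square_integrableD(1)[OF f] square_integrableD(1)[OF g]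
  show "integrable lebesgue (\<lambda>x. (cmod (f x))\<^sup>2 + (cmod (g x))\<^sup>2)"
    using f g by (auto dest: square_integrableD)
  show "AE x in lebesgue. norm (f x * g x) \<le> norm ((cmod (f x))\<^sup>2 + (cmod (g x))\<^sup>2)"
  proof (intro AE_I2)
    fix x
    have "2 * (cmod (f x) * cmod (g x)) \<le> (cmod (f x))\<^sup>2 + (cmod (g x))\<^sup>2"
      using sum_squares_bound[of "cmod (f x)" "cmod (g x)"] by simp
    moreover have "0 \<le> cmod (f x) * cmod (g x)" by simp
    ultimately have "cmod (f x) * cmod (g x) \<le> (cmod (f x))\<^sup>2 + (cmod (g x))\<^sup>2"
      by linarith
    then show "norm (f x * g x) \<le> norm ((cmod (f x))\<^sup>2 + (cmod (g x))\<^sup>2)"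
      by (simp add: norm_mult)
  qed
qed (use square_integrableD(1)[OF f] square_integrableD(1)[OF g] in simp)

lemma L2_norm_nonneg: "0 \<le> L2_norm f"
  unfolding L2_norm_def by simp

lemma L2_norm_squared: "(L2_norm f)\<^sup>2 = (LINT x|lebesgue. (cmod (f x))\<^sup>2)"
  unfolding L2_norm_def by simp

lemma L2_norm_cnj: "L2_norm (\<lambda>x. cnj (f x)) = L2_norm f"
  unfolding L2_norm_def by simp

text \<open>The Cauchy--Schwarz inequality, transferred from the one for nonnegative integrals. As the pairing
  is bilinear, it also covers \<open>L2_inner\<close> after conjugating one factor.\<close>

lemma norm_pairing_le:
  assumes f: "square_integrable f" and g: "square_integrable g"
  shows "cmod (pairing f g) \<le> L2_norm f * L2_norm g"
proof -
  note [measurable] = square_integrableD(1)[OF f] square_integrableD(1)[OF g]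
  define I where "I = (LINT x|lebesgue. cmod (f x) * cmod (g x))"
  have "integrable lebesgue (\<lambda>x. norm (f x * g x))"
    by (intro integrable_norm square_integrable_mult_integrable f g)
  then have int: "integrable lebesgue (\<lambda>x. cmod (f x) * cmod (g x))"
    by (simp add: norm_mult)
  have "(\<integral>\<^sup>+x. ennreal (cmod (f x)) * ennreal (cmod (g x)) \<partial>lebesgue)\<^sup>2
      \<le> (\<integral>\<^sup>+x. (ennreal (cmod (f x)))\<^sup>2 \<partial>lebesgue) * (\<integral>\<^sup>+x. (ennreal (cmod (g x)))\<^sup>2 \<partial>lebesgue)"
    by (rule Cauchy_Schwarz_nn_integral) auto
  moreover have "(\<integral>\<^sup>+x. ennreal (cmod (f x)) * ennreal (cmod (g x)) \<partial>lebesgue) = ennreal I"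
    unfolding I_def using int by (simp add: nn_integral_eq_integral flip: ennreal_mult)
  moreover have "(\<integral>\<^sup>+x. (ennreal (cmod (f x)))\<^sup>2 \<partial>lebesgue) = ennreal ((L2_norm f)\<^sup>2)"
    "(\<integral>\<^sup>+x. (ennreal (cmod (g x)))\<^sup>2 \<partial>lebesgue) = ennreal ((L2_norm g)\<^sup>2)"
    using f g by (simp_all add: L2_norm_squared nn_integral_eq_integral ennreal_power square_integrableD)
  moreover have I0: "0 \<le> I" unfolding I_def by simp
  ultimately have "ennreal (I\<^sup>2) \<le> ennreal ((L2_norm f)\<^sup>2 * (L2_norm g)\<^sup>2)"
    by (simp add: ennreal_power ennreal_mult L2_norm_nonneg)
  then have "I\<^sup>2 \<le> (L2_norm f * L2_norm g)\<^sup>2"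
    by (simp add: power_mult_distrib)
  then have "I \<le> L2_norm f * L2_norm g"
    by (rule power2_le_imp_le) (simp add: L2_norm_nonneg)
  moreover have "cmod (pairing f g) \<le> I"
    unfolding pairing_def I_def using integral_norm_bound[of lebesgue "\<lambda>x. f x * g x"] by (simp add: norm_mult)
  ultimately show ?thesis by simp
qed

lemma pairing_diff_left:
  assumes "square_integrable f" "square_integrable g" "square_integrable h"
  shows "pairing (\<lambda>x. f x - g x) h = pairing f h - pairing g h"
  unfolding pairing_def using assms
  by (simp add: left_diff_distrib square_integrable_mult_integrable)

lemma pairing_sum_left:
  assumes "\<And>i. i \<in> S \<Longrightarrow> square_integrable (e i)" "square_integrable h"
  shows "pairing (\<lambda>x. \<Sum>i\<in>S. a i * e i x) h = (\<Sum>i\<in>S. a i * pairing (e i) h)"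
proof -
  have "pairing (\<lambda>x. \<Sum>i\<in>S. a i * e i x) h = (LINT x|lebesgue. (\<Sum>i\<in>S. a i * (e i x * h x)))"
    unfolding pairing_def by (simp add: sum_distrib_right mult.assoc)
  also have "\<dots> = (\<Sum>i\<in>S. a i * pairing (e i) h)"
    unfolding pairing_def using assms
    by (subst Bochner_Integration.integral_sum) (auto intro!: square_integrable_mult_integrable integrable_mult_right)
  finally show ?thesis .
qed

lemma tendsto_pairing_of_tendsto_L2:
  assumes h: "tendsto_L2 h g F" and \<phi>: "square_integrable \<phi>"
  shows "((\<lambda>i. pairing (h i) \<phi>) \<longlongrightarrow> pairing g \<phi>) F"
proof -
  have g: "square_integrable g" and ev: "\<forall>\<^sub>F i in F. square_integrable (h i)"
    and lim: "((\<lambda>i. L2_norm (\<lambda>x. h i x - g x)) \<longlongrightarrow> 0) F"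
    using h unfolding tendsto_L2_def by auto
  have "((\<lambda>i. L2_norm (\<lambda>x. h i x - g x) * L2_norm \<phi>) \<longlongrightarrow> 0) F"
    using tendsto_mult_left_zero[OF lim] .
  moreover have "\<forall>\<^sub>F i in F. norm (pairing (h i) \<phi> - pairing g \<phi>) \<le> L2_norm (\<lambda>x. h i x - g x) * L2_norm \<phi>"
    using ev
  proof eventually_elim
    case (elim i)
    then show ?case
      using norm_pairing_le[OF square_integrable_diff[OF elim g] \<phi>] pairing_diff_left[OF elim g \<phi>] by simp
  qed
  ultimately have "((\<lambda>i. pairing (h i) \<phi> - pairing g \<phi>) \<longlongrightarrow> 0) F"
    by (rule Lim_null_comparison[rotated])
  then show ?thesis by (simp add: LIM_zero_iff)
qed

text \<open>A squared triangle inequality with the constant $2$: it follows pointwise from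
  \<open>norm_add_squared_le\<close>, and the lost constant is harmless in convergence arguments.\<close>

lemma L2_norm_diff_squared_le:
  assumes u: "square_integrable u" and v: "square_integrable v" and w: "square_integrable w"
  shows "(L2_norm (\<lambda>x. u x - w x))\<^sup>2 \<le> 2 * (L2_norm (\<lambda>x. u x - v x))\<^sup>2 + 2 * (L2_norm (\<lambda>x. v x - w x))\<^sup>2"
proof -
  note I = square_integrableD(2)[OF square_integrable_diff]
  have "(L2_norm (\<lambda>x. u x - w x))\<^sup>2 \<le> (LINT x|lebesgue. 2 * (cmod (u x - v x))\<^sup>2 + 2 * (cmod (v x - w x))\<^sup>2)"
    unfolding L2_norm_squared
  proof (rule integral_mono)
    show "(cmod (u x - w x))\<^sup>2 \<le> 2 * (cmod (u x - v x))\<^sup>2 + 2 * (cmod (v x - w x))\<^sup>2" for x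
      using norm_add_squared_le[of "u x - v x" "v x - w x"] by simp
  qed (use I[OF u v] I[OF v w] I[OF u w] in auto)
  also have "\<dots> = 2 * (L2_norm (\<lambda>x. u x - v x))\<^sup>2 + 2 * (L2_norm (\<lambda>x. v x - w x))\<^sup>2"
    using I[OF u v] I[OF v w] by (simp add: L2_norm_squared)
  finally show ?thesis .
qed

lemma L2_inner_eq_pairing: "L2_inner f g = pairing f (\<lambda>x. cnj (g x))"
  by (simp add: L2_inner_def pairing_def)

lemma cnj_L2_inner: "cnj (L2_inner f g) = L2_inner g f"
  unfolding L2_inner_def Bochner_Integration.integral_cnj[symmetric] by (simp add: mult.commute)

lemma L2_inner_self: "L2_inner f f = of_real ((L2_norm f)\<^sup>2)"
  unfolding L2_inner_def L2_norm_squared integral_complex_of_real[symmetric]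
  by (simp only: complex_norm_square)

lemma L2_inner_sum_left:
  assumes "\<And>i. i \<in> S \<Longrightarrow> square_integrable (e i)" "square_integrable h"
  shows "L2_inner (\<lambda>x. \<Sum>i\<in>S. a i * e i x) h = (\<Sum>i\<in>S. a i * L2_inner (e i) h)"
  unfolding L2_inner_eq_pairing using assms by (intro pairing_sum_left square_integrable_cnj)

locale orthonormal_system =
  fixes e :: "'i \<Rightarrow> real \<Rightarrow> complex"
  assumes square_integrable: "square_integrable (e i)"
    and orthonormal: "L2_inner (e i) (e i') = (if i = i' then 1 else 0)"
begin

lemma square_integrable_comb: "square_integrable (\<lambda>x. \<Sum>i\<in>S. a i * e i x)"
  by (intro square_integrable_sum square_integrable_scale square_integrable)

lemma L2_norm_comb_squared:
  assumes "finite S"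
  shows "(L2_norm (\<lambda>x. \<Sum>i\<in>S. a i * e i x))\<^sup>2 = (\<Sum>i\<in>S. (cmod (a i))\<^sup>2)"
proof -
  let ?g = "\<lambda>x. \<Sum>i\<in>S. a i * e i x"
  have inner: "L2_inner (e i) ?g = cnj (a i)" if "i \<in> S" for i
  proof -
    have "L2_inner ?g (e i) = (\<Sum>i'\<in>S. a i' * L2_inner (e i') (e i))"
      by (intro L2_inner_sum_left square_integrable)
    also have "\<dots> = a i"
      using that assms by (simp add: orthonormal if_distrib cong: if_cong)
    finally show ?thesis by (metis cnj_L2_inner)
  qed
  have "of_real ((L2_norm ?g)\<^sup>2) = L2_inner ?g ?g" by (simp add: L2_inner_self)
  also have "\<dots> = (\<Sum>i\<in>S. a i * L2_inner (e i) ?g)"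
    by (intro L2_inner_sum_left square_integrable square_integrable_comb)
  also have "\<dots> = (\<Sum>i\<in>S. of_real ((cmod (a i))\<^sup>2))"
    using inner by (intro sum.cong) (simp_all only: complex_norm_square)
  also have "\<dots> = of_real (\<Sum>i\<in>S. (cmod (a i))\<^sup>2)" by simp
  finally show ?thesis by (simp only: of_real_eq_iff)
qed

text \<open>Let $g$ be the orthogonal projection of $f$ and $s$ the sum in question. Then
  $s = \langle g, f\rangle \le \|g\|\,\|f\| = \sqrt{s}\,\|f\|$, and $\sqrt{s}$ cancels.\<close>

lemma Bessel_inequality:
  assumes f: "square_integrable f" and S: "finite S"
  shows "(\<Sum>i\<in>S. (cmod (L2_inner f (e i)))\<^sup>2) \<le> (L2_norm f)\<^sup>2"
proof -
  define s where "s = (\<Sum>i\<in>S. (cmod (L2_inner f (e i)))\<^sup>2)"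
  let ?g = "\<lambda>x. \<Sum>i\<in>S. L2_inner f (e i) * e i x"
  have s0: "0 \<le> s" unfolding s_def by (simp add: sum_nonneg)
  have "L2_inner ?g f = (\<Sum>i\<in>S. L2_inner f (e i) * L2_inner (e i) f)"
    by (intro L2_inner_sum_left square_integrable f)
  also have "\<dots> = of_real s"
    unfolding s_def of_real_sum
    by (intro sum.cong) (simp_all only: complex_norm_square cnj_L2_inner)
  finally have "s = cmod (L2_inner ?g f)" using s0 by simp
  also have "\<dots> \<le> L2_norm ?g * L2_norm f"
    unfolding L2_inner_eq_pairing
    using norm_pairing_le[OF square_integrable_comb square_integrable_cnj[OF f]] by (simp add: L2_norm_cnj)
  finally have "s \<le> L2_norm ?g * L2_norm f" .
  then have "s\<^sup>2 \<le> s * (L2_norm f)\<^sup>2"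
    using power_mono[of s "L2_norm ?g * L2_norm f" 2] s0
    by (simp add: power_mult_distrib L2_norm_comb_squared[OF S] s_def)
  then show ?thesis
    using s0 unfolding s_def[symmetric] by (cases "s = 0") (auto simp: power2_eq_square)
qed

end


text \<open>The completeness of $L^2$. With increments $d_n$ of squared norm at most $8^{-n}$, the function
  $D = \sum_n 4^n |d_n|^2$ has integral at most $\sum_n 2^{-n}$ and is finite almost everywhere. There
  $|d_n| \le \sqrt{D}\,2^{-n}$, so the sequence converges pointwise and stays within $2\sqrt{D}$ of
  its limit; the integrable function $4D$ then dominates the squared distances.\<close>

lemma rapidly_Cauchy_imp_tendsto_L2:
  fixes h :: "nat \<Rightarrow> real \<Rightarrow> complex"
  assumes h: "\<And>n. square_integrable (h n)"
    and step: "\<And>n. (L2_norm (\<lambda>x. h (Suc n) x - h n x))\<^sup>2 \<le> (1/8) ^ n"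
  shows "\<exists>g. tendsto_L2 h g sequentially"
proof -
  note hm[measurable] = square_integrableD(1)[OF h]
  define d where "d n x = h (Suc n) x - h n x" for n x
  have d: "square_integrable (d n)" for n
    unfolding d_def by (intro square_integrable_diff h)
  note [measurable] = square_integrableD(1)[OF d]
  \<comment> \<open>The weights \<open>4 ^ n\<close> leave the summable bound \<open>(1/2) ^ n\<close> for the integrals and at the same
    time force geometric decay of the increments wherever \<open>D\<close> is finite.\<close>
  define D where "D x = (\<Sum>n. ennreal (4 ^ n * (cmod (d n x))\<^sup>2))" for x
  have Dm[measurable]: "D \<in> borel_measurable lebesgue" unfolding D_def by measurable
  have "(\<integral>\<^sup>+x. D x \<partial>lebesgue) = (\<Sum>n. \<integral>\<^sup>+x. ennreal (4 ^ n * (cmod (d n x))\<^sup>2) \<partial>lebesgue)"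
    unfolding D_def by (rule nn_integral_suminf) measurable
  also have "\<dots> \<le> (\<Sum>n. ennreal ((1/2) ^ n))"
  proof (intro suminf_le allI)
    fix n
    have "(\<integral>\<^sup>+x. ennreal (4 ^ n * (cmod (d n x))\<^sup>2) \<partial>lebesgue) = ennreal (4 ^ n * (L2_norm (d n))\<^sup>2)"
      using square_integrableD(2)[OF d] by (subst nn_integral_eq_integral) (auto simp: L2_norm_squared)
    also have "\<dots> \<le> ennreal (4 ^ n * (1/8) ^ n)"
      using step[of n] unfolding d_def by (intro ennreal_leI mult_left_mono) auto
    also have "(4::real) ^ n * (1/8) ^ n = (1/2) ^ n"
      by (simp flip: power_mult_distrib)
    finally show "(\<integral>\<^sup>+x. ennreal (4 ^ n * (cmod (d n x))\<^sup>2) \<partial>lebesgue) \<le> ennreal ((1/2) ^ n)" .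
  qed auto
  also have "\<dots> = ennreal (\<Sum>n. (1/2) ^ n)"
    by (intro suminf_ennreal2) (auto intro: summable_geometric)
  also have "\<dots> < \<infinity>" by simp
  finally have Dint: "(\<integral>\<^sup>+x. D x \<partial>lebesgue) < \<infinity>" .
  have Dfin: "AE x in lebesgue. D x \<noteq> \<infinity>"
    using Dint by (intro nn_integral_PInf_AE) auto
  define E where "E x = enn2real (D x)" for x
  have [measurable]: "E \<in> borel_measurable lebesgue" unfolding E_def by measurable
  have Eint: "integrable lebesgue E"
  proof (rule integrableI_nonneg)
    have "(\<integral>\<^sup>+x. ennreal (E x) \<partial>lebesgue) = (\<integral>\<^sup>+x. D x \<partial>lebesgue)"
      using Dfin by (intro nn_integral_cong_AE) (auto simp: E_def less_top)
    with Dint show "(\<integral>\<^sup>+x. ennreal (E x) \<partial>lebesgue) < \<infinity>" by simp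
  qed (auto simp: E_def)
  define g where "g x = lim (\<lambda>n. h n x)" for x
  have gm[measurable]: "g \<in> borel_measurable lebesgue" unfolding g_def by measurable
  have pt: "(\<lambda>n. h n x) \<longlonglongrightarrow> g x" "\<And>n. (cmod (h n x - g x))\<^sup>2 \<le> 4 * E x" if "D x \<noteq> \<infinity>" for x
  proof -
    have DE: "D x = ennreal (E x)" using that by (simp add: E_def less_top)
    have E0: "0 \<le> E x" by (simp add: E_def)
    have four: "(2 ^ n)\<^sup>2 = (4::real) ^ n" for n
      by (simp flip: power_mult power_mult_distrib add: power2_eq_square)
    have dn: "cmod (d n x) \<le> sqrt (E x) * (1/2) ^ n" for n
    proof -
      have "(\<Sum>k\<in>{n}. ennreal (4 ^ k * (cmod (d k x))\<^sup>2)) \<le> D x"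
        unfolding D_def by (rule sum_le_suminf) auto
      then have "ennreal (4 ^ n * (cmod (d n x))\<^sup>2) \<le> ennreal (E x)"
        unfolding DE by simp
      then have "4 ^ n * (cmod (d n x))\<^sup>2 \<le> E x"
        using E0 by (subst (asm) ennreal_le_iff)
      then have "(2 ^ n * cmod (d n x))\<^sup>2 \<le> E x"
        unfolding power_mult_distrib four .
      then have "2 ^ n * cmod (d n x) \<le> sqrt (E x)" by (rule real_le_rsqrt)
      then show ?thesis by (simp add: power_one_over pos_le_divide_eq mult.commute)
    qed
    have geo: "summable (\<lambda>n. sqrt (E x) * (1/2::real) ^ n)"
      by (intro summable_mult summable_geometric) auto
    have tele: "h m x - h n x = (\<Sum>k\<in>{n..<m}. d k x)" if "n \<le> m" for m n
      using sum_Suc_diff'[OF that, of "\<lambda>k. h k x"] by (simp add: d_def)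
    have sd: "summable (\<lambda>n. d n x)"
      by (rule summable_comparison_test'[OF geo, of 0]) (use dn in auto)
    have "h n x = h 0 x + (\<Sum>k<n. d k x)" for n
      using tele[OF le0, of n] unfolding atLeast0LessThan by (simp only: diff_eq_eq add.commute)
    then have "(\<lambda>n. h n x) = (\<lambda>n. h 0 x + (\<Sum>k<n. d k x))" by (rule ext)
    moreover have "convergent (\<lambda>n. h 0 x + (\<Sum>k<n. d k x))"
      using sd by (intro convergent_add convergent_const) (simp add: summable_iff_convergent)
    ultimately show lim: "(\<lambda>n. h n x) \<longlonglongrightarrow> g x"
      unfolding g_def by (simp add: convergent_LIMSEQ_iff)
    have bd: "cmod (h n x - h m x) \<le> 2 * sqrt (E x)" if "n \<le> m" for m n
    proof -
      have "cmod (h n x - h m x) = cmod (\<Sum>k\<in>{n..<m}. d k x)"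
        using tele[OF that] by (metis norm_minus_commute)
      also have "\<dots> \<le> (\<Sum>k\<in>{n..<m}. sqrt (E x) * (1/2) ^ k)"
        by (rule sum_norm_le) (use dn in auto)
      also have "\<dots> \<le> (\<Sum>k. sqrt (E x) * (1/2) ^ k)"
        using E0 by (intro sum_le_suminf geo) auto
      also have "\<dots> = 2 * sqrt (E x)"
        by (subst suminf_mult) (auto simp: suminf_geometric summable_geometric)
      finally show ?thesis .
    qed
    show "(cmod (h n x - g x))\<^sup>2 \<le> 4 * E x" for n
    proof -
      have "cmod (h n x - g x) \<le> 2 * sqrt (E x)"
        by (rule LIMSEQ_le_const2[OF tendsto_norm[OF tendsto_diff[OF tendsto_const lim]]])
           (use bd in auto)
      then have "(cmod (h n x - g x))\<^sup>2 \<le> (2 * sqrt (E x))\<^sup>2" by (rule power_mono) simp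
      then show ?thesis using E0 by (simp add: power_mult_distrib)
    qed
  qed
  have int0: "integrable lebesgue (\<lambda>x. (cmod (h n x - g x))\<^sup>2)" for n
  proof (rule Bochner_Integration.integrable_bound)
    show "integrable lebesgue (\<lambda>x. 4 * E x)" using Eint by simp
    show "AE x in lebesgue. norm ((cmod (h n x - g x))\<^sup>2) \<le> norm (4 * E x)"
      using Dfin pt(2)[of _ n] by (auto simp: E_def elim!: eventually_mono)
  qed measurable
  then have "square_integrable (\<lambda>x. h 0 x - g x)"
    unfolding square_integrable_def by simp
  then have "square_integrable (\<lambda>x. h 0 x - (h 0 x - g x))"
    by (rule square_integrable_diff[OF h])
  then have g: "square_integrable g" by simp
  have "(\<lambda>n. LINT x|lebesgue. (cmod (h n x - g x))\<^sup>2) \<longlonglongrightarrow> (LINT x::real|lebesgue. (0::real))"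
  proof (rule integral_dominated_convergence[where w="\<lambda>x. 4 * E x"])
    show "integrable lebesgue (\<lambda>x. 4 * E x)" using Eint by simp
    show "AE x in lebesgue. norm ((cmod (h n x - g x))\<^sup>2) \<le> 4 * E x" for n
      using Dfin by (auto simp: pt(2) elim!: eventually_mono)
    show "AE x in lebesgue. (\<lambda>n. (cmod (h n x - g x))\<^sup>2) \<longlonglongrightarrow> 0"
      using Dfin
    proof eventually_elim
      case (elim x)
      have "(\<lambda>n. (cmod (h n x - g x))\<^sup>2) \<longlonglongrightarrow> (cmod (g x - g x))\<^sup>2"
        by (intro tendsto_intros pt(1) elim)
      then show ?case by simp
    qed
  qed auto
  then have "(\<lambda>n. L2_norm (\<lambda>x. h n x - g x)) \<longlonglongrightarrow> 0"
    unfolding L2_norm_def using tendsto_real_sqrt by fastforce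
  then show ?thesis
    unfolding tendsto_L2_def using h g by auto
qed

text \<open>The Riesz--Fischer theorem for unconditional sums. Finite sets $G_n$ that exhaust the sum of the
  squares up to $8^{-n}$ give a rapidly Cauchy sequence of partial sums, and every partial sum over a
  larger set is as close to its limit as the remaining squares are small.\<close>

lemma (in orthonormal_system) square_summable_imp_tendsto_L2:
  assumes bound: "\<And>S. finite S \<Longrightarrow> (\<Sum>i\<in>S. (cmod (a i))\<^sup>2) \<le> B"
  shows "\<exists>g. tendsto_L2 (\<lambda>S x. \<Sum>i\<in>S. a i * e i x) g (finite_subsets_at_top UNIV)"
proof -
  define s where "s S = (\<Sum>i\<in>S. (cmod (a i))\<^sup>2)" for S
  define P where "P S x = (\<Sum>i\<in>S. a i * e i x)" for S x
  have P: "square_integrable (P S)" for S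
    unfolding P_def by (rule square_integrable_comb)
  have Pdiff: "(L2_norm (\<lambda>x. P S x - P T x))\<^sup>2 = s (S - T)" if "finite S" "T \<subseteq> S" for S T
    unfolding P_def s_def using that
    by (simp add: L2_norm_comb_squared flip: sum_diff)
  define U where "U = Sup (s ` {S. finite S})"
  have bdd: "bdd_above (s ` {S. finite S})"
    using bound unfolding s_def by (intro bdd_aboveI[of _ B]) auto
  have le_U: "s S \<le> U" if "finite S" for S
    unfolding U_def using that bdd by (intro cSup_upper) auto
  have "\<exists>S. finite S \<and> U - (1/8)^n < s S" for n
  proof -
    have "U - (1/8)^n < U" by simp
    then have "\<exists>y\<in>s ` {S. finite S}. U - (1/8)^n < y"
      unfolding U_def using bdd by (intro less_cSupD) auto
    then show ?thesis by auto
  qed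
  then obtain F where F: "\<And>n. finite (F n)" "\<And>n. U - (1/8)^n < s (F n)" by metis
  define G where "G n = (\<Union>i\<le>n. F i)" for n
  have G: "finite (G n)" "F n \<subseteq> G n" "G n \<subseteq> G (Suc n)" for n
    using F(1) unfolding G_def by (auto intro: le_SucI)
  have small: "s (S - G n) \<le> (1/8)^n" if "finite S" for S n
  proof -
    have "s (S - G n) + s (F n) = s ((S - G n) \<union> F n)"
      unfolding s_def using that F(1) G by (intro sum.union_disjoint[symmetric]) auto
    also have "\<dots> \<le> U" using that F(1) by (intro le_U) auto
    finally show ?thesis using F(2)[of n] by linarith
  qed
  have "\<exists>g. tendsto_L2 (\<lambda>n. P (G n)) g sequentially"
    using Pdiff small G P by (intro rapidly_Cauchy_imp_tendsto_L2) auto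
  then obtain g where g: "square_integrable g"
    and lim: "(\<lambda>n. L2_norm (\<lambda>x. P (G n) x - g x)) \<longlonglongrightarrow> 0"
    unfolding tendsto_L2_def by auto
  have "(\<lambda>n. 2 * (1/8::real)^n + 2 * (L2_norm (\<lambda>x. P (G n) x - g x))\<^sup>2) \<longlonglongrightarrow> 2 * 0 + 2 * 0\<^sup>2"
    by (intro tendsto_intros lim LIMSEQ_power_zero) auto
  then have lim2: "(\<lambda>n. 2 * (1/8::real)^n + 2 * (L2_norm (\<lambda>x. P (G n) x - g x))\<^sup>2) \<longlonglongrightarrow> 0" by simp
  have "((\<lambda>S. L2_norm (\<lambda>x. P S x - g x)) \<longlongrightarrow> 0) (finite_subsets_at_top UNIV)"
  proof (rule tendstoI)
    fix \<delta> :: real assume \<delta>: "\<delta> > 0"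
    then have "\<forall>\<^sub>F n in sequentially. 2 * (1/8::real)^n + 2 * (L2_norm (\<lambda>x. P (G n) x - g x))\<^sup>2 < \<delta>\<^sup>2"
      using order_tendstoD(2)[OF lim2, of "\<delta>\<^sup>2"] by simp
    then obtain n where n: "2 * (1/8::real)^n + 2 * (L2_norm (\<lambda>x. P (G n) x - g x))\<^sup>2 < \<delta>\<^sup>2"
      by (meson eventually_sequentially order_refl)
    show "\<forall>\<^sub>F S in finite_subsets_at_top UNIV. dist (L2_norm (\<lambda>x. P S x - g x)) 0 < \<delta>"
      unfolding eventually_finite_subsets_at_top
    proof (intro exI[of _ "G n"] conjI allI impI)
      fix S assume S: "finite S \<and> G n \<subseteq> S \<and> S \<subseteq> UNIV"
      have "(L2_norm (\<lambda>x. P S x - g x))\<^sup>2 \<le> 2 * s (S - G n) + 2 * (L2_norm (\<lambda>x. P (G n) x - g x))\<^sup>2"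
        using L2_norm_diff_squared_le[OF P P g, of S "G n"] Pdiff[of S "G n"] S by simp
      also have "\<dots> < \<delta>\<^sup>2" using small[of S n] S n by simp
      finally have "L2_norm (\<lambda>x. P S x - g x) < \<delta>"
        using \<delta> by (intro power2_less_imp_less[of _ \<delta>]) auto
      then show "dist (L2_norm (\<lambda>x. P S x - g x)) 0 < \<delta>"
        by (simp add: L2_norm_nonneg)
    qed (use G in auto)
  qed
  then show ?thesis
    unfolding tendsto_L2_def using P g unfolding P_def by auto
qed

section \<open>Fourier inversion and separation of frequency bands\<close>

lemma sigma_finite_lebesgue: "sigma_finite_measure (lebesgue :: real measure)"
proof
  show "\<exists>A::real set set. countable A \<and> A \<subseteq> sets lebesgue \<and> \<Union>A = space lebesgue \<and> (\<forall>a\<in>A. emeasure lebesgue a \<noteq> \<infinity>)"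
  proof (intro exI[of _ "range (\<lambda>n::nat. {- real n..real n})"] conjI)
    have "\<exists>n::nat. x \<in> {- real n..real n}" for x :: real
      using real_arch_simple[of "\<bar>x\<bar>"] by (auto simp: abs_le_iff minus_le_iff)
    then show "\<Union> (range (\<lambda>n::nat. {- real n..real n})) = space lebesgue" by auto
  qed auto
qed

interpretation lebesgue: sigma_finite_measure "lebesgue :: real measure"
  by (rule sigma_finite_lebesgue)

interpretation lebesgue_pair: pair_sigma_finite "lebesgue :: real measure" "lebesgue :: real measure" ..

text \<open>Oscillating kernels of modulus at most one do not destroy integrability on a product space; this is
  the form in which Fubini's theorem is applied below.\<close>

lemma (in pair_sigma_finite) integrable_bounded_by_product:
  fixes F :: "'a \<times> 'b \<Rightarrow> complex" and u :: "'a \<Rightarrow> complex" and v :: "'b \<Rightarrow> complex"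
  assumes F[measurable]: "F \<in> borel_measurable (M1 \<Otimes>\<^sub>M M2)"
    and u: "integrable M1 u" and v: "integrable M2 v"
    and bound: "\<And>x y. cmod (F (x, y)) \<le> cmod (u x) * cmod (v y)"
  shows "integrable (M1 \<Otimes>\<^sub>M M2) F"
proof (rule Bochner_Integration.integrable_bound)
  have [measurable]: "u \<in> borel_measurable M1" "v \<in> borel_measurable M2"
    using u v by auto
  show "integrable (M1 \<Otimes>\<^sub>M M2) (\<lambda>(x, y). u x * v y)"
    by (rule Fubini_integrable) (use u v in \<open>auto simp: norm_mult\<close>)
  show "AE z in M1 \<Otimes>\<^sub>M M2. norm (F z) \<le> norm ((\<lambda>(x, y). u x * v y) z)"
    using bound by (intro AE_I2) (auto simp: norm_mult)
qed fact

lemma fourier_lborel: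
  assumes [measurable]: "g \<in> borel_measurable borel"
  shows "fourier g \<omega> = (LINT x|lborel. exp (- (\<i> * of_real (\<omega> * x))) * g x)"
  unfolding fourier_def by (rule integral_completion) measurable

lemma borel_measurable_fourier:
  assumes [measurable]: "g \<in> borel_measurable borel"
  shows "fourier g \<in> borel_measurable borel"
proof -
  have "(\<lambda>\<omega>. LINT x|lborel. exp (- (\<i> * of_real (\<omega> * x))) * g x) \<in> borel_measurable borel"
    by measurable
  moreover have "fourier g = (\<lambda>\<omega>. LINT x|lborel. exp (- (\<i> * of_real (\<omega> * x))) * g x)"
    by (intro ext fourier_lborel) simp
  ultimately show ?thesis by simp
qed

lemma norm_fourier_le: "cmod (fourier g \<omega>) \<le> (LINT x|lebesgue. cmod (g x))"
  unfolding fourier_def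
  using integral_norm_bound[of lebesgue "\<lambda>x. exp (- (\<i> * of_real (\<omega> * x))) * g x"]
  by (simp add: norm_mult)

text \<open>The Gaussian is its own Fourier transform up to scaling: this is the characteristic function of the
  standard normal distribution after the substitution $z = s\omega$.\<close>

lemma fourier_gaussian:
  assumes s: "s > 0"
  shows "(LINT \<omega>|lborel. exp (\<i> * of_real (\<omega> * t)) * of_real (std_normal_density (s * \<omega>)))
       = of_real (sqrt (2 * pi) / s * std_normal_density (t / s))"
proof -
  have e: "sqrt (2 * pi) / s * std_normal_density (t / s) = exp (- ((t / s)\<^sup>2) / 2) / s"
    by (simp add: std_normal_density_def)
  have "complex_of_real (exp (- ((t / s)\<^sup>2) / 2)) = char std_normal_distribution (t / s)"
    by (simp add: char_std_normal_distribution)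
  also have "\<dots> = (LINT z|lborel. std_normal_density z *\<^sub>R iexp (t / s * z))"
    unfolding char_def by (subst integral_density) (auto simp: mult_ac)
  also have "\<dots> = \<bar>s\<bar> *\<^sub>R (LINT \<omega>|lborel. std_normal_density (0 + s * \<omega>) *\<^sub>R iexp (t / s * (0 + s * \<omega>)))"
    using s by (intro lborel_integral_real_affine) auto
  also have "\<dots> = of_real s * (LINT \<omega>|lborel. exp (\<i> * of_real (\<omega> * t)) * of_real (std_normal_density (s * \<omega>)))"
    using s by (simp add: scaleR_conv_of_real mult_ac)
  finally show ?thesis
    using s unfolding e by (simp add: nonzero_eq_divide_eq mult.commute)
qed

lemma integrable_std_normal_density_scaled:
  assumes "s > 0"
  shows "integrable lborel (\<lambda>\<omega>. complex_of_real (std_normal_density (s * \<omega>)))"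
proof -
  have "integrable lborel (\<lambda>\<omega>. std_normal_density (0 + s * \<omega>))"
    by (rule lborel_integrable_real_affine) (use assms in auto)
  then show ?thesis by simp
qed

text \<open>Damp the integrand with the Gaussian $\varphi(s\omega)$. By Fubini's theorem the damped integral is
  the average of $g$ over a Gaussian of width $s$ around $x$, times $\sqrt{2\pi}$. Letting $s \to 0$,
  dominated convergence gives the undamped integral times $\varphi(0) = 1/\sqrt{2\pi}$ on one side,
  and by continuity $\sqrt{2\pi}\,g(x)$ on the other.\<close>

lemma fourier_inversion:
  assumes cont: "continuous_on UNIV g"
    and bound: "\<And>x. cmod (g x) \<le> B"
    and int: "integrable lborel g"
    and fint: "integrable lborel (fourier g)"
  shows "(LINT \<omega>|lborel. exp (\<i> * of_real (\<omega> * x)) * fourier g \<omega>) = of_real (2 * pi) * g x"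
proof -
  have [measurable]: "g \<in> borel_measurable borel"
    using cont by (rule borel_measurable_continuous_onI)
  have [measurable]: "fourier g \<in> borel_measurable borel"
    by (rule borel_measurable_fourier) simp
  define s :: "nat \<Rightarrow> real" where "s n = 1 / real (Suc n)" for n
  have s: "s n > 0" for n by (simp add: s_def)
  have s_lim: "s \<longlonglongrightarrow> 0" unfolding s_def by (rule LIMSEQ_Suc[OF lim_1_over_n])
  let ?\<phi> = std_normal_density
  have \<phi>_le: "?\<phi> z \<le> ?\<phi> 0" for z by (simp add: std_normal_density_def divide_simps)
  have smooth: "(LINT \<omega>|lborel. exp (\<i> * of_real (\<omega> * x)) * fourier g \<omega> * of_real (?\<phi> (s n * \<omega>)))
      = of_real (sqrt (2 * pi)) * (LINT z|lborel. g (x + s n * z) * of_real (?\<phi> z))" for n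
  proof -
    let ?F = "\<lambda>y \<omega>. exp (\<i> * of_real (\<omega> * (x - y))) * g y * of_real (?\<phi> (s n * \<omega>))"
    have "integrable (lborel \<Otimes>\<^sub>M lborel) (case_prod ?F)"
    proof (rule lborel_pair.integrable_bounded_by_product[OF _ int integrable_std_normal_density_scaled[OF s[of n]]])
      show "case_prod ?F \<in> borel_measurable (lborel \<Otimes>\<^sub>M lborel)" by measurable
    qed (simp add: norm_mult)
    note fub = lborel_pair.Fubini_integral[OF this]
    have "(LINT \<omega>|lborel. exp (\<i> * of_real (\<omega> * x)) * fourier g \<omega> * of_real (?\<phi> (s n * \<omega>)))
        = (LINT \<omega>|lborel. LINT y|lborel. ?F y \<omega>)"
    proof (intro Bochner_Integration.integral_cong refl)
      fix \<omega>
      have "exp (\<i> * of_real (\<omega> * x)) * fourier g \<omega> * of_real (?\<phi> (s n * \<omega>))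
         = (LINT y|lborel. (exp (\<i> * of_real (\<omega> * x)) * of_real (?\<phi> (s n * \<omega>))) * (exp (- (\<i> * of_real (\<omega> * y))) * g y))"
        unfolding integral_mult_right_zero by (simp add: fourier_lborel)
      also have "\<dots> = (LINT y|lborel. ?F y \<omega>)"
        by (intro Bochner_Integration.integral_cong refl) (simp add: exp_diff exp_minus field_simps right_diff_distrib)
      finally show "exp (\<i> * of_real (\<omega> * x)) * fourier g \<omega> * of_real (?\<phi> (s n * \<omega>)) = (LINT y|lborel. ?F y \<omega>)" .
    qed
    also have "\<dots> = (LINT y|lborel. LINT \<omega>|lborel. ?F y \<omega>)" by (rule fub)
    also have "\<dots> = (LINT y|lborel. g y * of_real (sqrt (2 * pi) / s n * ?\<phi> ((x - y) / s n)))"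
    proof (intro Bochner_Integration.integral_cong refl)
      fix y
      have "(LINT \<omega>|lborel. ?F y \<omega>)
          = (LINT \<omega>|lborel. g y * (exp (\<i> * of_real (\<omega> * (x - y))) * of_real (?\<phi> (s n * \<omega>))))"
        by (simp only: mult_ac)
      then show "(LINT \<omega>|lborel. ?F y \<omega>) = g y * of_real (sqrt (2 * pi) / s n * ?\<phi> ((x - y) / s n))"
        unfolding integral_mult_right_zero fourier_gaussian[OF s] .
    qed
    \<comment> \<open>The substitution \<open>y = x + s n * z\<close> cancels the factor \<open>1 / s n\<close>; the Gaussian is even.\<close>
    also have "\<dots> = \<bar>s n\<bar> *\<^sub>R (LINT z|lborel. g (x + s n * z) * of_real (sqrt (2 * pi) / s n * ?\<phi> ((x - (x + s n * z)) / s n)))"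
      using s[of n] by (intro lborel_integral_real_affine) auto
    also have "\<dots> = \<bar>s n\<bar> *\<^sub>R (LINT z|lborel. of_real (sqrt (2 * pi) / s n) * (g (x + s n * z) * of_real (?\<phi> z)))"
      using s[of n] by (intro arg_cong[where f="scaleR _"] Bochner_Integration.integral_cong refl)
        (simp add: std_normal_density_def)
    also have "\<dots> = of_real (sqrt (2 * pi)) * (LINT z|lborel. g (x + s n * z) * of_real (?\<phi> z))"
      using s[of n] by (subst integral_mult_right_zero) (simp add: scaleR_conv_of_real)
    finally show ?thesis .
  qed
  have "(\<lambda>n. LINT \<omega>|lborel. exp (\<i> * of_real (\<omega> * x)) * fourier g \<omega> * of_real (?\<phi> (s n * \<omega>)))
     \<longlonglongrightarrow> (LINT \<omega>|lborel. exp (\<i> * of_real (\<omega> * x)) * fourier g \<omega> * of_real (?\<phi> (0 * \<omega>)))"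
  proof (rule integral_dominated_convergence)
    show "integrable lborel (\<lambda>\<omega>. cmod (fourier g \<omega>) * ?\<phi> 0)" using fint by auto
    show "AE \<omega> in lborel. (\<lambda>n. exp (\<i> * of_real (\<omega> * x)) * fourier g \<omega> * of_real (?\<phi> (s n * \<omega>)))
         \<longlonglongrightarrow> exp (\<i> * of_real (\<omega> * x)) * fourier g \<omega> * of_real (?\<phi> (0 * \<omega>))"
      unfolding std_normal_density_def by (intro AE_I2 tendsto_intros s_lim) auto
    show "AE \<omega> in lborel. norm (exp (\<i> * of_real (\<omega> * x)) * fourier g \<omega> * of_real (?\<phi> (s n * \<omega>))) \<le> cmod (fourier g \<omega>) * ?\<phi> 0" for n
      using \<phi>_le by (intro AE_I2) (auto simp: norm_mult intro!: mult_left_mono)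
  qed measurable
  moreover have "(\<lambda>n. LINT z|lborel. g (x + s n * z) * of_real (?\<phi> z)) \<longlonglongrightarrow> (LINT z|lborel. g (x + 0 * z) * of_real (?\<phi> z))"
  proof (rule integral_dominated_convergence)
    show "integrable lborel (\<lambda>z. B * ?\<phi> z)" by auto
    show "AE z in lborel. (\<lambda>n. g (x + s n * z) * of_real (?\<phi> z)) \<longlonglongrightarrow> g (x + 0 * z) * of_real (?\<phi> z)"
      by (intro AE_I2 tendsto_mult tendsto_const continuous_on_tendsto_compose[OF cont] tendsto_add s_lim) auto
    show "AE z in lborel. norm (g (x + s n * z) * of_real (?\<phi> z)) \<le> B * ?\<phi> z" for n
      using bound by (intro AE_I2) (auto simp: norm_mult intro!: mult_right_mono)
  qed measurable
  ultimately have "(LINT \<omega>|lborel. exp (\<i> * of_real (\<omega> * x)) * fourier g \<omega> * of_real (?\<phi> (0 * \<omega>)))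
     = of_real (sqrt (2 * pi)) * (LINT z|lborel. g (x + 0 * z) * of_real (?\<phi> z))"
    unfolding smooth by (intro LIMSEQ_unique[OF _ tendsto_mult[OF tendsto_const]])
  also have "(LINT z|lborel. g (x + 0 * z) * of_real (?\<phi> z)) = g x"
    by simp
  finally show ?thesis
    by (simp add: std_normal_density_def field_simps flip: of_real_mult)
qed

lemma square_integrable_indicator: "square_integrable (indicator {-R..R})"
proof -
  have "(\<lambda>x::real. (cmod (indicator {-R..R} x))\<^sup>2) = indicator {-R..R}"
    by (auto simp: indicator_def)
  moreover have "integrable lebesgue (indicator {-R..R} :: real \<Rightarrow> real)"
    by (intro integrable_real_indicator) (auto simp: emeasure_lborel_Icc_eq)
  moreover have "(indicator {-R..R} :: real \<Rightarrow> complex) \<in> borel_measurable lebesgue"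
    by (rule borel_measurable_indicator) simp
  ultimately show ?thesis
    unfolding square_integrable_def by simp
qed

lemma square_integrable_of_bounded_integrable:
  assumes g: "integrable lebesgue g" and bound: "\<And>x. cmod (g x) \<le> B"
  shows "square_integrable g"
proof -
  have [measurable]: "g \<in> borel_measurable lebesgue" using g by auto
  have "integrable lebesgue (\<lambda>x. (cmod (g x))\<^sup>2)"
  proof (rule Bochner_Integration.integrable_bound)
    show "integrable lebesgue (\<lambda>x. B * cmod (g x))" using g by auto
    have "(cmod (g x))\<^sup>2 \<le> B * cmod (g x)" for x
      unfolding power2_eq_square by (intro mult_right_mono bound) auto
    then show "AE x in lebesgue. norm ((cmod (g x))\<^sup>2) \<le> norm (B * cmod (g x))"
      by (intro AE_I2) (smt (verit) real_norm_def zero_le_power2)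
  qed measurable
  then show ?thesis unfolding square_integrable_def by simp
qed

text \<open>For the truncations of $\psi$, which are integrable, this is Fubini's theorem after inserting the
  inversion formula for $g$. Both sides pass to the limit: the left one by dominated convergence, the
  right one because the transforms of the truncations converge in $L^2$ by the definition of the
  Plancherel transform. The reflection of the argument is due to the absence of a complex conjugation
  in the pairing.\<close>

lemma Parseval_pairing:
  assumes \<psi>: "square_integrable \<psi>" and \<psi>hat: "has_L2_fourier \<psi> \<psi>hat"
    and cont: "continuous_on UNIV g" and bound: "\<And>x. cmod (g x) \<le> B"
    and int: "integrable lborel g" and fint: "integrable lborel (fourier g)"
  shows "of_real (2 * pi) * pairing \<psi> g = pairing \<psi>hat (\<lambda>\<omega>. fourier g (- \<omega>))"
proof -
  have gm[measurable]: "g \<in> borel_measurable borel"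
    using cont by (rule borel_measurable_continuous_onI)
  have fm[measurable]: "fourier g \<in> borel_measurable borel"
    by (rule borel_measurable_fourier) simp
  have \<psi>m: "\<psi> \<in> borel_measurable lebesgue"
    using \<psi> by (rule square_integrableD)
  \<comment> \<open>With \<open>v\<close> in place of the transform of \<open>g\<close>, the inversion formula acquires the kernel of the
    forward transform, which is what reappears as the transform of \<open>\<psi>\<close>.\<close>
  define v where "v \<omega> = fourier g (- \<omega>)" for \<omega>
  have vm[measurable]: "v \<in> borel_measurable borel" unfolding v_def by measurable
  have "integrable lborel v"
    using lborel_integrable_real_affine[OF fint, of "-1" 0] by (simp add: v_def[abs_def])
  then have vint: "integrable lebesgue v"
    by (subst integrable_completion) auto
  have vsq: "square_integrable v"
    by (rule square_integrable_of_bounded_integrable[OF vint, of "LINT x|lebesgue. cmod (g x)"])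
       (simp add: v_def norm_fourier_le)
  have gsq: "square_integrable g"
    using int by (intro square_integrable_of_bounded_integrable[OF _ bound]) (subst integrable_completion, auto)
  have inv: "of_real (2 * pi) * g x = (LINT \<omega>|lebesgue. exp (- (\<i> * of_real (\<omega> * x))) * v \<omega>)" for x
  proof -
    have "of_real (2 * pi) * g x = (LINT \<omega>|lborel. exp (\<i> * of_real (\<omega> * x)) * fourier g \<omega>)"
      by (rule fourier_inversion[OF cont bound int fint, symmetric])
    also have "\<dots> = (LINT \<omega>|lborel. exp (- (\<i> * of_real (\<omega> * x))) * v \<omega>)"
      by (subst lborel_integral_real_affine[of "-1" _ 0]) (auto simp: v_def)
    also have "\<dots> = (LINT \<omega>|lebesgue. exp (- (\<i> * of_real (\<omega> * x))) * v \<omega>)"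
      by (rule integral_completion[symmetric]) measurable
    finally show ?thesis .
  qed
  have trunc: "of_real (2 * pi) * pairing (\<lambda>x. indicator {-R..R} x * \<psi> x) g
      = pairing (fourier (\<lambda>x. indicator {-R..R} x * \<psi> x)) v" for R
  proof -
    define p where "p x = indicator {-R..R} x * \<psi> x" for x
    have p: "integrable lebesgue p"
      unfolding p_def by (intro square_integrable_mult_integrable \<psi> square_integrable_indicator)
    let ?F = "\<lambda>x \<omega>. exp (- (\<i> * of_real (\<omega> * x))) * p x * v \<omega>"
    have "integrable (lebesgue \<Otimes>\<^sub>M lebesgue) (case_prod ?F)"
    proof (rule lebesgue_pair.integrable_bounded_by_product[OF _ p vint])
      have [measurable]: "p \<in> borel_measurable lebesgue" "v \<in> borel_measurable lebesgue"
        using p vint by auto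
      have [measurable]: "(\<lambda>x::real. x) \<in> borel_measurable lebesgue"
        by (rule measurable_completion) simp
      have [measurable]: "(\<lambda>z::real \<times> real. fst z) \<in> borel_measurable (lebesgue \<Otimes>\<^sub>M lebesgue)"
        "(\<lambda>z::real \<times> real. snd z) \<in> borel_measurable (lebesgue \<Otimes>\<^sub>M lebesgue)"
        by (rule measurable_compose[OF measurable_fst], simp)
           (rule measurable_compose[OF measurable_snd], simp)
      show "case_prod ?F \<in> borel_measurable (lebesgue \<Otimes>\<^sub>M lebesgue)"
        unfolding case_prod_beta by measurable
    qed (simp add: norm_mult)
    note fub = lebesgue_pair.Fubini_integral[OF this]
    have "of_real (2 * pi) * pairing p g = (LINT x|lebesgue. p x * (of_real (2 * pi) * g x))"
      unfolding pairing_def by (simp add: mult_ac flip: integral_mult_right_zero)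
    also have "\<dots> = (LINT x|lebesgue. LINT \<omega>|lebesgue. ?F x \<omega>)"
      unfolding inv by (simp add: mult_ac flip: integral_mult_right_zero)
    also have "\<dots> = (LINT \<omega>|lebesgue. LINT x|lebesgue. ?F x \<omega>)" by (rule fub[symmetric])
    also have "\<dots> = pairing (fourier p) v"
      unfolding pairing_def fourier_def by simp
    finally show ?thesis unfolding p_def .
  qed
  have "((\<lambda>R. pairing (\<lambda>x. indicator {-R..R} x * \<psi> x) g) \<longlongrightarrow> pairing \<psi> g) at_top"
    unfolding pairing_def
  proof (rule integral_dominated_convergence_at_top)
    have I: "integrable lebesgue (\<lambda>x. \<psi> x * g x)" by (intro square_integrable_mult_integrable \<psi> gsq)
    then show "integrable lebesgue (\<lambda>x. cmod (\<psi> x * g x))" by auto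
    show "(\<lambda>x. \<psi> x * g x) \<in> borel_measurable lebesgue" using I by auto
    show "(\<lambda>x. indicator {-R..R} x * \<psi> x * g x) \<in> borel_measurable lebesgue" for R
      using square_integrableD(1)[OF square_integrable_indicator, of R] \<psi>m square_integrableD(1)[OF gsq]
      by (intro borel_measurable_times)
    show "\<forall>\<^sub>F R in at_top. AE x in lebesgue. norm (indicator {-R..R} x * \<psi> x * g x) \<le> cmod (\<psi> x * g x)"
      by (intro always_eventually allI AE_I2) (auto simp: indicator_def)
    show "AE x in lebesgue. ((\<lambda>R. indicator {-R..R} x * \<psi> x * g x) \<longlongrightarrow> \<psi> x * g x) at_top"
    proof (intro AE_I2 tendsto_eventually)
      fix x :: real
      show "\<forall>\<^sub>F R in at_top. indicator {-R..R} x * \<psi> x * g x = \<psi> x * g x"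
        using eventually_ge_at_top[of "\<bar>x\<bar>"] by eventually_elim (auto simp: indicator_def)
    qed
  qed
  then have "((\<lambda>R. of_real (2 * pi) * pairing (\<lambda>x. indicator {-R..R} x * \<psi> x) g) \<longlongrightarrow> of_real (2 * pi) * pairing \<psi> g) at_top"
    by (intro tendsto_intros)
  moreover have "((\<lambda>R. of_real (2 * pi) * pairing (\<lambda>x. indicator {-R..R} x * \<psi> x) g) \<longlongrightarrow> pairing \<psi>hat v) at_top"
    unfolding trunc using \<psi>hat vsq unfolding has_L2_fourier_def by (rule tendsto_pairing_of_tendsto_L2)
  ultimately show ?thesis
    unfolding v_def by (intro tendsto_unique[OF trivial_limit_at_top_linorder])
qed

text \<open>The complement of the essential support is a union of possibly uncountably many open sets on which
  $g$ vanishes almost everywhere; by Lindeloef's theorem countably many of them suffice.\<close>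

lemma AE_eq_0_outside_ess_support: "AE x in lebesgue. x \<notin> ess_support g \<longrightarrow> g x = 0"
proof -
  let ?U = "{U. open U \<and> (AE x in lebesgue. x \<in> U \<longrightarrow> g x = 0)}"
  obtain V where V: "V \<subseteq> ?U" "countable V" "\<Union>V = \<Union>?U"
    using Lindelof[of ?U] by auto
  have "AE x in lebesgue. \<forall>U\<in>V. x \<in> U \<longrightarrow> g x = 0"
    using V by (intro AE_ball_countable') auto
  then show ?thesis
    unfolding ess_support_def V(3)[symmetric] by eventually_elim auto
qed

lemma integrable_inverse_1_plus_square_UNIV: "integrable lborel (\<lambda>x::real. inverse (1 + x\<^sup>2))"
  using integrable_inverse_1_plus_square by (simp add: set_integrable_def einterval_def)

lemma schwartz_imp_continuous_bounded_integrable: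
  assumes "schwartz \<kappa>"
  shows "continuous_on UNIV \<kappa>" "\<exists>B. \<forall>x. cmod (\<kappa> x) \<le> B" "integrable lborel \<kappa>"
proof -
  have diff: "\<And>x. \<kappa> differentiable (at x)" and decay: "\<And>m::nat. \<exists>C. \<forall>x. \<bar>x\<bar> ^ m * cmod (\<kappa> x) \<le> C"
    using assms[unfolded schwartz_def, rule_format, of 0] by (auto simp: Let_def)
  show cont: "continuous_on UNIV \<kappa>"
    using diff by (auto intro!: continuous_at_imp_continuous_on differentiable_imp_continuous_within)
  then have [measurable]: "\<kappa> \<in> borel_measurable borel" by (rule borel_measurable_continuous_onI)
  obtain C0 where C0: "\<And>x. cmod (\<kappa> x) \<le> C0" using decay[of 0] by auto
  obtain C2 where C2: "\<And>x. x\<^sup>2 * cmod (\<kappa> x) \<le> C2" using decay[of 2] by auto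
  show "\<exists>B. \<forall>x. cmod (\<kappa> x) \<le> B" using C0 by auto
  show "integrable lborel \<kappa>"
  proof (rule Bochner_Integration.integrable_bound)
    show "integrable lborel (\<lambda>x. (C0 + C2) * inverse (1 + x\<^sup>2))"
      using integrable_inverse_1_plus_square_UNIV by auto
    have "cmod (\<kappa> x) \<le> (C0 + C2) * inverse (1 + x\<^sup>2)" for x
    proof -
      have "0 < 1 + x\<^sup>2" by (simp add: add_pos_nonneg)
      then show ?thesis using C0[of x] C2[of x] by (simp add: field_simps)
    qed
    then show "AE x in lborel. norm (\<kappa> x) \<le> norm ((C0 + C2) * inverse (1 + x\<^sup>2))"
      by (intro AE_I2) (metis abs_ge_self order_trans real_norm_def)
  qed simp
qed

lemma fourier_affine:
  assumes a: "a > 0"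
  shows "fourier (\<lambda>y. \<kappa> ((y - b) / a)) \<omega> = of_real a * exp (- (\<i> * of_real (\<omega> * b))) * fourier \<kappa> (a * \<omega>)"
proof -
  have "fourier (\<lambda>y. \<kappa> ((y - b) / a)) \<omega>
      = \<bar>a\<bar> *\<^sub>R (LINT z|lebesgue. exp (- (\<i> * of_real (\<omega> * (b + a * z)))) * \<kappa> ((b + a * z - b) / a))"
    unfolding fourier_def using a by (intro lebesgue_integral_real_affine) auto
  also have "\<dots> = of_real a * (LINT z|lebesgue. exp (- (\<i> * of_real (\<omega> * b))) * (exp (- (\<i> * of_real (a * \<omega> * z))) * \<kappa> z))"
  proof -
    have "exp (- (\<i> * of_real (\<omega> * (b + a * z)))) * \<kappa> ((b + a * z - b) / a)
        = exp (- (\<i> * of_real (\<omega> * b))) * (exp (- (\<i> * of_real (a * \<omega> * z))) * \<kappa> z)" for z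
    proof -
      have "- (\<i> * of_real (\<omega> * (b + a * z))) = - (\<i> * of_real (\<omega> * b)) + - (\<i> * complex_of_real (a * \<omega> * z))"
        by (simp add: algebra_simps)
      moreover have "(b + a * z - b) / a = z" using a by simp
      ultimately show ?thesis by (simp only: exp_add mult.assoc)
    qed
    then show ?thesis using a by (simp only: scaleR_conv_of_real abs_of_pos)
  qed
  finally show ?thesis unfolding fourier_def by (simp add: mult.assoc)
qed

lemma affine_continuous_bounded_integrable:
  fixes \<kappa> :: "real \<Rightarrow> complex"
  assumes a: "a > 0" and cont: "continuous_on UNIV \<kappa>" and int: "integrable lborel \<kappa>"
  shows "continuous_on UNIV (\<lambda>y. \<kappa> ((y - b) / a))" "integrable lborel (\<lambda>y. \<kappa> ((y - b) / a))"
proof -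
  show "continuous_on UNIV (\<lambda>y. \<kappa> ((y - b) / a))"
  proof (rule continuous_on_compose2[OF cont])
    show "continuous_on UNIV (\<lambda>y. (y - b) / a)"
      using a by (intro continuous_intros) auto
  qed auto
  show "integrable lborel (\<lambda>y. \<kappa> ((y - b) / a))"
    using lborel_integrable_real_affine[OF int, of "1 / a" "- b / a"] a
    by (simp add: diff_divide_distrib add.commute)
qed

text \<open>Dilating $\kappa$ by $a$ moves its spectrum to $[c/a, d/a]$, and the reflection in Parseval's formula
  moves it to $[-d/a, -c/a]$, which misses the band $[-R, R]$ of $\psi$ once $aR < c$.\<close>

lemma pairing_low_band_high_band_eq_0:
  assumes \<psi>: "square_integrable \<psi>" and \<psi>hat: "has_L2_fourier \<psi> \<psi>hat"
    and band: "AE \<omega> in lebesgue. \<bar>\<omega>\<bar> > R \<longrightarrow> \<psi>hat \<omega> = 0"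
    and \<kappa>: "schwartz \<kappa>" and supp: "\<And>\<omega>. fourier \<kappa> \<omega> \<noteq> 0 \<Longrightarrow> \<omega> \<in> {c..d}"
    and a: "a > 0" "a * R < c"
  shows "pairing \<psi> (\<lambda>y. \<kappa> ((y - b) / a)) = 0"
proof -
  define g where "g y = \<kappa> ((y - b) / a)" for y
  note K = schwartz_imp_continuous_bounded_integrable[OF \<kappa>]
  obtain B where B: "\<And>x. cmod (\<kappa> x) \<le> B" using K(2) by auto
  have cont: "continuous_on UNIV g" and int: "integrable lborel g" and bound: "\<And>x. cmod (g x) \<le> B"
    using affine_continuous_bounded_integrable[OF a(1) K(1,3)] B unfolding g_def by auto
  have fm[measurable]: "fourier g \<in> borel_measurable borel"
    using cont by (intro borel_measurable_fourier borel_measurable_continuous_onI)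
  have fsupp: "a * \<omega> \<in> {c..d}" if "fourier g \<omega> \<noteq> 0" for \<omega>
    using that supp[of "a * \<omega>"] unfolding g_def fourier_affine[OF a(1)] by auto
  have fint: "integrable lborel (fourier g)"
  proof (rule Bochner_Integration.integrable_bound)
    let ?C = "LINT x|lebesgue. cmod (g x)"
    show "integrable lborel (\<lambda>\<omega>. ?C * indicator {c / a..d / a} \<omega>)"
      by (intro integrable_mult_right integrable_real_indicator) (auto simp: emeasure_lborel_Icc_eq)
    show "AE \<omega> in lborel. norm (fourier g \<omega>) \<le> norm (?C * indicator {c / a..d / a} \<omega>)"
    proof (intro AE_I2)
      fix \<omega>
      show "norm (fourier g \<omega>) \<le> norm (?C * indicator {c / a..d / a} \<omega>)"
      proof (cases "fourier g \<omega> = 0")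
        case False
        then have "\<omega> \<in> {c / a..d / a}" using fsupp[of \<omega>] a(1) by (simp add: field_simps)
        then show ?thesis using norm_fourier_le[of g \<omega>] by simp
      qed simp
    qed
  qed simp
  have "pairing \<psi>hat (\<lambda>\<omega>. fourier g (- \<omega>)) = (LINT \<omega>::real|lebesgue. 0)"
    unfolding pairing_def
  proof (rule integral_cong_AE)
    have "\<psi>hat \<in> borel_measurable lebesgue"
      using \<psi>hat unfolding has_L2_fourier_def tendsto_L2_def by (auto dest: square_integrableD)
    moreover have "(\<lambda>\<omega>. fourier g (- \<omega>)) \<in> borel_measurable lebesgue"
      by (rule measurable_completion) simp
    ultimately show "(\<lambda>\<omega>. \<psi>hat \<omega> * fourier g (- \<omega>)) \<in> borel_measurable lebesgue"
      by (rule borel_measurable_times)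
    show "AE \<omega> in lebesgue. \<psi>hat \<omega> * fourier g (- \<omega>) = 0"
      using band
    proof eventually_elim
      case (elim \<omega>)
      show ?case
      proof (rule ccontr)
        assume "\<psi>hat \<omega> * fourier g (- \<omega>) \<noteq> 0"
        then have "\<bar>\<omega>\<bar> \<le> R" "c \<le> a * (- \<omega>)" using elim fsupp[of "- \<omega>"] by (auto simp: not_less)
        moreover have "a * (- \<omega>) \<le> a * \<bar>\<omega>\<bar>" using a(1) by (intro mult_left_mono) auto
        moreover have "a * \<bar>\<omega>\<bar> \<le> a * R" using a(1) \<open>\<bar>\<omega>\<bar> \<le> R\<close> by (intro mult_left_mono) auto
        ultimately show False using a(2) by linarith
      qed
    qed
  qed simp
  then have "of_real (2 * pi) * pairing \<psi> g = 0"
    using Parseval_pairing[OF \<psi> \<psi>hat cont bound int fint] by simp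
  then show ?thesis by (simp add: g_def[abs_def])
qed

text \<open>The affine change of variables $y = 2^j x - k$ moves the scaling of the wavelet to the test function,
  so that only $\psi$ itself has to be studied on the frequency side.\<close>

lemma pairing_wavelet_dilate:
  "pairing (wavelet \<psi> (j, k)) (dilate \<kappa> a b)
    = of_real (2 powr (real_of_int j / 2) * 2 powi (- j) / sqrt a)
      * pairing \<psi> (\<lambda>y. \<kappa> ((y - (2 powi j * b - real_of_int k)) / (2 powi j * a)))"
proof -
  define q :: real where "q = 2 powi j"
  have q: "q > 0" by (simp add: q_def)
  let ?f = "\<lambda>x. wavelet \<psi> (j, k) x * dilate \<kappa> a b x"
  have "pairing (wavelet \<psi> (j, k)) (dilate \<kappa> a b) = \<bar>1 / q\<bar> *\<^sub>R (LINT y|lebesgue. ?f (real_of_int k / q + 1 / q * y))"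
    unfolding pairing_def using q by (intro lebesgue_integral_real_affine) auto
  also have "(\<lambda>y. ?f (real_of_int k / q + 1 / q * y))
      = (\<lambda>y. of_real (2 powr (real_of_int j / 2) / sqrt a) * (\<psi> y * \<kappa> ((y - (q * b - real_of_int k)) / (q * a))))"
  proof
    fix y
    have "q * (real_of_int k / q + 1 / q * y) - real_of_int k = y"
      using q by (simp add: field_simps)
    moreover have "(real_of_int k / q + 1 / q * y - b) / a = (y - (q * b - real_of_int k)) / (q * a)"
      using q by (cases "a = 0") (simp_all add: field_simps)
    ultimately show "?f (real_of_int k / q + 1 / q * y)
        = of_real (2 powr (real_of_int j / 2) / sqrt a) * (\<psi> y * \<kappa> ((y - (q * b - real_of_int k)) / (q * a)))"
      by (simp add: wavelet_def dilate_def q_def[symmetric])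
  qed
  also have "\<bar>1 / q\<bar> *\<^sub>R (LINT y|lebesgue. of_real (2 powr (real_of_int j / 2) / sqrt a) * (\<psi> y * \<kappa> ((y - (q * b - real_of_int k)) / (q * a))))
      = of_real (2 powr (real_of_int j / 2) * inverse q / sqrt a) * pairing \<psi> (\<lambda>y. \<kappa> ((y - (q * b - real_of_int k)) / (q * a)))"
  proof -
    have "\<bar>1 / q\<bar> *\<^sub>R (of_real (A / sqrt a) * I) = of_real (A * inverse q / sqrt a) * I" for A and I :: complex
      using q by (simp add: scaleR_conv_of_real field_simps)
    then show ?thesis unfolding integral_mult_right_zero pairing_def .
  qed
  finally show ?thesis
    unfolding q_def power_int_minus .
qed

lemma eventually_pairing_wavelet_dilate_eq_0:
  assumes \<psi>: "square_integrable \<psi>" and \<psi>hat: "has_L2_fourier \<psi> \<psi>hat"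
    and compact: "compact (ess_support \<psi>hat)" and \<kappa>: "signature_wavelet \<kappa>"
  shows "\<forall>\<^sub>F a in at_right 0. pairing (wavelet \<psi> p) (dilate \<kappa> a b) = 0"
proof -
  obtain j k where p: "p = (j, k)" by (cases p)
  obtain c d where c: "0 < c" and supp: "closure {\<omega>. fourier \<kappa> \<omega> \<noteq> 0} \<subseteq> {c..d}" and S: "schwartz \<kappa>"
    using \<kappa> unfolding signature_wavelet_def by (elim conjE exE) (rule that)
  have supp': "\<omega> \<in> {c..d}" if "fourier \<kappa> \<omega> \<noteq> 0" for \<omega>
    using that subsetD[OF closure_subset, of \<omega> "{\<omega>. fourier \<kappa> \<omega> \<noteq> 0}"] supp by auto
  obtain R where R: "R > 0" "\<And>\<omega>. \<omega> \<in> ess_support \<psi>hat \<Longrightarrow> \<bar>\<omega>\<bar> \<le> R"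
    using compact_imp_bounded[OF compact] unfolding bounded_pos real_norm_def by blast
  have band: "AE \<omega> in lebesgue. \<bar>\<omega>\<bar> > R \<longrightarrow> \<psi>hat \<omega> = 0"
    using AE_eq_0_outside_ess_support[of \<psi>hat] by eventually_elim (use R(2) in \<open>meson not_le\<close>)
  have "0 < c / (2 powi j * R)" using c R by simp
  then have "\<forall>\<^sub>F a in at_right 0. a \<in> {0<..<c / (2 powi j * R)}"
    by (rule eventually_at_right_real)
  then show ?thesis
  proof eventually_elim
    case (elim a)
    then have "0 < 2 powi j * a" "2 powi j * a * R < c" using R by (auto simp: field_simps)
    then show ?case
      unfolding p pairing_wavelet_dilate
      using pairing_low_band_high_band_eq_0[OF \<psi> \<psi>hat band S supp'] by simp
  qed
qed

section \<open>Odd tail functionals of independent symmetric variables\<close>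

text \<open>A set of sequences that is invariant under zeroing finitely many coordinates defines a tail event:
  for each $N$ membership can be read off from the sequence with its first $N$ entries replaced
  by $0$, which is measurable with respect to the remaining variables.\<close>

lemma (in prob_space) tail_event_prob_0_or_1:
  fixes X :: "nat \<Rightarrow> 'a \<Rightarrow> real"
  assumes ind: "indep_vars (\<lambda>_. borel) X UNIV"
    and A: "A \<in> sets (PiM UNIV (\<lambda>_. borel))"
    and tail: "\<And>N e. (\<lambda>i. if i < N then 0 else e i) \<in> A \<longleftrightarrow> e \<in> A"
  shows "prob {w \<in> space M. (\<lambda>i. X i w) \<in> A} = 0 \<or> prob {w \<in> space M. (\<lambda>i. X i w) \<in> A} = 1"
proof (rule kolmogorov_0_1_law)
  define F where "F i = sigma_sets (space M) {X i -` B \<inter> space M |B. B \<in> sets (borel :: real measure)}" for i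
  show "sigma_algebra (space M) (F i)" for i
    unfolding F_def by (rule sigma_algebra_sigma_sets) auto
  show "indep_sets F UNIV"
    using ind unfolding indep_vars_def F_def by simp
  show "{w \<in> space M. (\<lambda>i. X i w) \<in> A} \<in> tail_events F"
    unfolding tail_events_def
  proof (rule InterI, clarify)
    fix N :: nat
    define T where "T = sigma (space M) (\<Union>(F ` {N..}))"
    have sub: "\<Union>(F ` {N..}) \<subseteq> Pow (space M)"
      unfolding F_def by (auto dest!: sigma_sets_into_sp[rotated])
    have spT: "space T = space M" and setsT: "sets T = sigma_sets (space M) (\<Union>(F ` {N..}))"
      using sub by (simp_all add: T_def space_measure_of sets_measure_of)
    have X: "X i \<in> borel_measurable T" if "N \<le> i" for i
    proof (rule measurableI)
      fix B :: "real set" assume "B \<in> sets borel"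
      then have "X i -` B \<inter> space M \<in> F i"
        unfolding F_def by (intro sigma_sets.Basic) auto
      then show "X i -` B \<inter> space T \<in> sets T"
        using that unfolding spT setsT by (intro sigma_sets.Basic) auto
    qed auto
    have "(\<lambda>w i. if i < N then 0 else X i w) \<in> T \<rightarrow>\<^sub>M PiM UNIV (\<lambda>_. borel)"
      proof (rule measurable_PiM_single')
      show "(\<lambda>w. if i < N then 0 else X i w) \<in> borel_measurable T" for i
        using X[of i] by (cases "i < N") auto
    qed auto
    from measurable_sets[OF this A]
    have "{w \<in> space T. (\<lambda>i. if i < N then 0 else X i w) \<in> A} \<in> sets T"
      by (simp add: vimage_def Int_def conj_commute)
    then show "{w \<in> space M. (\<lambda>i. X i w) \<in> A} \<in> sigma_sets (space M) (\<Union>(F ` {N..}))"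
      unfolding spT setsT tail .
  qed
qed

text \<open>The joint law of independent variables is the product of the marginal laws, which flipping
  the signs does not change.\<close>

lemma (in prob_space) distr_uminus_independent:
  fixes X :: "'i \<Rightarrow> 'a \<Rightarrow> real"
  assumes ind: "indep_vars (\<lambda>_. borel) X UNIV"
    and sym: "\<And>i. distr M borel (\<lambda>w. - X i w) = distr M borel (X i)"
  shows "distr M (PiM UNIV (\<lambda>_. borel)) (\<lambda>w i. - X i w) = distr M (PiM UNIV (\<lambda>_. borel)) (\<lambda>w i. X i w)"
proof -
  have rv: "\<And>i. random_variable borel (X i)"
    using ind unfolding indep_vars_def2 by simp
  have "indep_vars (\<lambda>_. borel) (\<lambda>i w. - X i w) UNIV"
    using indep_vars_compose2[OF ind, of "\<lambda>_ x. - x" "\<lambda>_. borel"] by simp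
  with ind rv show ?thesis
    by (subst (asm) (1 2) indep_vars_iff_distr_eq_PiM) (auto simp: sym restrict_UNIV)
qed

text \<open>By oddness and symmetry the events $G > 0$ and $G < 0$ are equally likely. They are disjoint, so
  neither has probability one, and the zero-one law makes both null.\<close>

lemma (in prob_space) odd_tail_functional_eq_0:
  fixes X :: "nat \<Rightarrow> 'a \<Rightarrow> real" and G :: "(nat \<Rightarrow> real) \<Rightarrow> real"
  assumes ind: "indep_vars (\<lambda>_. borel) X UNIV"
    and sym: "\<And>i. distr M borel (\<lambda>w. - X i w) = distr M borel (X i)"
    and G: "G \<in> borel_measurable (PiM UNIV (\<lambda>_. borel))"
    and tail: "\<And>N e. G (\<lambda>i. if i < N then 0 else e i) = G e"
    and odd: "\<And>e. G (\<lambda>i. - e i) = - G e"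
  shows "AE w in M. G (\<lambda>i. X i w) = 0"
proof -
  have rv[measurable]: "\<And>i. X i \<in> borel_measurable M"
    using ind unfolding indep_vars_def2 by simp
  note G[measurable]
  have "{e \<in> space (PiM UNIV (\<lambda>_::nat. borel :: real measure)). 0 < G e} \<in> sets (PiM UNIV (\<lambda>_. borel))"
    by measurable
  then have pos: "{e. 0 < G e} \<in> sets (PiM UNIV (\<lambda>_. borel))"
    by (simp add: space_PiM)
  have mX[measurable]: "(\<lambda>w i. X i w) \<in> M \<rightarrow>\<^sub>M PiM UNIV (\<lambda>_. borel)"
    by (rule measurable_PiM_single') auto
  have mX': "(\<lambda>w i. - X i w) \<in> M \<rightarrow>\<^sub>M PiM UNIV (\<lambda>_. borel)"
    by (rule measurable_PiM_single') auto
  have mG[measurable]: "(\<lambda>w. G (\<lambda>i. X i w)) \<in> borel_measurable M"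
    by measurable
  let ?P = "{w \<in> space M. 0 < G (\<lambda>i. X i w)}" and ?N = "{w \<in> space M. G (\<lambda>i. X i w) < 0}"
  have "prob ?P = measure (distr M (PiM UNIV (\<lambda>_. borel)) (\<lambda>w i. X i w)) {e. 0 < G e}"
    using pos by (subst measure_distr) (auto intro!: arg_cong[where f=prob])
  also have "\<dots> = measure (distr M (PiM UNIV (\<lambda>_. borel)) (\<lambda>w i. - X i w)) {e. 0 < G e}"
    by (simp add: distr_uminus_independent[OF ind sym])
  also have "\<dots> = prob ?N"
    using pos mX' by (subst measure_distr) (auto simp: odd intro!: arg_cong[where f=prob])
  finally have eq: "prob ?P = prob ?N" .
  have "prob ?P + prob ?N = prob (?P \<union> ?N)"
    by (rule finite_measure_Union[symmetric]) auto
  also have "\<dots> \<le> 1" by (rule prob_le_1)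
  finally have "prob ?P \<noteq> 1"
    using eq by auto
  moreover have "prob ?P = 0 \<or> prob ?P = 1"
    using tail_event_prob_0_or_1[OF ind pos] by (simp add: tail)
  ultimately have "prob ?P = 0" "prob ?N = 0"
    using eq by auto
  then have "AE w in M. w \<notin> ?P" "AE w in M. w \<notin> ?N"
    by (auto simp: prob_eq_0)
  then show ?thesis
    by (rule AE_mp[OF _ AE_mp]) (auto intro!: AE_I2)
qed


text \<open>If each coefficient sequence $n \mapsto d_{n,i}$ is eventually zero, then each single variable
  influences only finitely many of the sums, so the limit of their signs is a tail functional. Negating
  all variables negates it.\<close>

lemma (in prob_space) sgn_random_series_no_nonzero_limit:
  fixes X :: "nat \<Rightarrow> 'a \<Rightarrow> real" and d :: "nat \<Rightarrow> nat \<Rightarrow> complex"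
  assumes ind: "indep_vars (\<lambda>_. borel) X UNIV"
    and sym: "\<And>i. distr M borel (\<lambda>w. - X i w) = distr M borel (X i)"
    and d: "\<And>i. \<forall>\<^sub>F n in sequentially. d n i = 0"
  shows "AE w in M. \<forall>x l. (\<forall>n. (\<lambda>i. of_real (X i w) * d n i) sums x n) \<longrightarrow>
           (\<lambda>n. sgn (x n)) \<longlonglongrightarrow> l \<longrightarrow> l = 0"
proof -
  \<comment> \<open>Off the sets of convergence \<open>suminf\<close> and \<open>lim\<close> take unspecified values, which need not be odd
    in \<open>e\<close>; the default value \<open>0\<close> keeps \<open>L\<close> odd everywhere.\<close>
  define s where "s e n = (if summable (\<lambda>i. of_real (e i) * d n i)
      then sgn (\<Sum>i. of_real (e i) * d n i) else 0)" for e :: "nat \<Rightarrow> real" and n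
  define L where "L e = (if convergent (s e) then lim (s e) else 0)" for e
  have [measurable]: "(\<lambda>e. s e n) \<in> borel_measurable (PiM UNIV (\<lambda>_. borel))" for n
    unfolding s_def summable_iff_convergent Cauchy_convergent_iff[symmetric] sgn_div_norm by measurable
  have L[measurable]: "L \<in> borel_measurable (PiM UNIV (\<lambda>_. borel))"
    unfolding L_def Cauchy_convergent_iff[symmetric] by measurable
  have tail: "L (\<lambda>i. if i < N then 0 else e i) = L e" for N e
  proof -
    let ?e = "\<lambda>i. if i < N then 0 else e i"
    have "\<forall>\<^sub>F n in sequentially. \<forall>i\<in>{..<N}. d n i = 0"
      using d by (intro eventually_ball_finite) auto
    then have ev: "\<forall>\<^sub>F n in sequentially. s ?e n = s e n"
    proof eventually_elim
      case (elim n)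
      then have "(\<lambda>i. of_real (?e i) * d n i) = (\<lambda>i. of_real (e i) * d n i)"
        by (auto simp: fun_eq_iff)
      then show ?case unfolding s_def by (metis (mono_tags, lifting))
    qed
    have "s ?e \<longlonglongrightarrow> l \<longleftrightarrow> s e \<longlonglongrightarrow> l" for l
      using ev by (rule tendsto_cong)
    then show ?thesis unfolding L_def convergent_def lim_def by auto
  qed
  have odd: "L (\<lambda>i. - e i) = - L e" for e
  proof -
    have eq: "s (\<lambda>i. - e i) = (\<lambda>n. - s e n)"
      by (auto simp: s_def summable_minus_iff suminf_minus sgn_minus fun_eq_iff)
    have "convergent (\<lambda>n. - s e n) \<longleftrightarrow> convergent (s e)"
      by (rule convergent_minus_iff[symmetric])
    moreover have "lim (\<lambda>n. - s e n) = - lim (s e)" if "convergent (s e)"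
      using that by (intro limI tendsto_minus) (simp add: convergent_LIMSEQ_iff)
    ultimately show ?thesis
      unfolding L_def eq by auto
  qed
  have "AE w in M. Re (L (\<lambda>i. X i w)) = 0"
    by (rule odd_tail_functional_eq_0[OF ind sym]) (auto simp: tail odd)
  moreover have "AE w in M. Im (L (\<lambda>i. X i w)) = 0"
    by (rule odd_tail_functional_eq_0[OF ind sym]) (auto simp: tail odd)
  ultimately show ?thesis
  proof eventually_elim
    case (elim w)
    then have L0: "L (\<lambda>i. X i w) = 0" by (simp add: complex_eq_iff)
    show ?case
    proof safe
      fix x l assume x: "\<forall>n. (\<lambda>i. of_real (X i w) * d n i) sums x n"
        and l: "(\<lambda>n. sgn (x n)) \<longlonglongrightarrow> l"
      have "s (\<lambda>i. X i w) = (\<lambda>n. sgn (x n))"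
        using x by (auto simp: s_def fun_eq_iff sums_iff)
      with l L0 show "l = 0"
        unfolding L_def by (auto simp: convergent_def dest: limI split: if_splits)
    qed
  qed
qed

lemma (in prob_space) rademacher_symmetric:
  assumes X[measurable]: "random_variable borel (X :: 'a \<Rightarrow> real)"
    and p1: "prob {w \<in> space M. X w = 1} = 1 / 2" and p2: "prob {w \<in> space M. X w = - 1} = 1 / 2"
  shows "AE w in M. X w \<in> {1, - 1}" "distr M borel (\<lambda>w. - X w) = distr M borel X"
proof -
  have split: "prob {w \<in> space M. (X w = 1 \<and> P) \<or> (X w = - 1 \<and> Q)} = of_bool P / 2 + of_bool Q / 2" for P Q
  proof -
    have "{w \<in> space M. (X w = 1 \<and> P) \<or> (X w = - 1 \<and> Q)}
        = {w \<in> space M. X w = 1 \<and> P} \<union> {w \<in> space M. X w = - 1 \<and> Q}" by auto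
    then have "prob {w \<in> space M. (X w = 1 \<and> P) \<or> (X w = - 1 \<and> Q)}
        = prob {w \<in> space M. X w = 1 \<and> P} + prob {w \<in> space M. X w = - 1 \<and> Q}"
      by (simp only:) (rule finite_measure_Union, auto)
    then show ?thesis by (cases P; cases Q) (simp_all add: p1 p2)
  qed
  have "prob {w \<in> space M. X w \<in> {1, - 1}} = 1"
    using split[of True True] by simp
  then show AE: "AE w in M. X w \<in> {1, - 1}"
    by (intro AE_I_eq_1) (auto simp: emeasure_eq_measure)
  show "distr M borel (\<lambda>w. - X w) = distr M borel X"
  proof (rule measure_eqI)
    fix B :: "real set" assume "B \<in> sets (distr M borel (\<lambda>w. - X w))"
    then have [measurable]: "B \<in> sets borel" by simp
    have "prob {w \<in> space M. - X w \<in> B} = prob {w \<in> space M. (X w = 1 \<and> - 1 \<in> B) \<or> (X w = - 1 \<and> 1 \<in> B)}"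
      using AE by (intro finite_measure_eq_AE) (auto elim!: eventually_mono)
    also have "\<dots> = prob {w \<in> space M. (X w = 1 \<and> 1 \<in> B) \<or> (X w = - 1 \<and> - 1 \<in> B)}"
      by (simp only: split add.commute)
    also have "\<dots> = prob {w \<in> space M. X w \<in> B}"
      using AE by (intro finite_measure_eq_AE) (auto elim!: eventually_mono)
    finally have "prob {w \<in> space M. - X w \<in> B} = prob {w \<in> space M. X w \<in> B}" .
    then show "emeasure (distr M borel (\<lambda>w. - X w)) B = emeasure (distr M borel X) B"
      by (simp add: emeasure_distr emeasure_eq_measure vimage_def Int_def conj_commute)
  qed simp
qed

lemma (in prob_space) indep_vars_reindex_inj:
  assumes ind: "indep_vars (\<lambda>_. N) X UNIV" and h: "inj h"
  shows "indep_vars (\<lambda>_. N) (\<lambda>i. X (h i)) UNIV"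
  unfolding indep_vars_def2
proof (intro conjI ballI)
  show "random_variable N (X (h i))" for i
    using ind unfolding indep_vars_def2 by blast
  let ?F = "\<lambda>p. {X p -` A \<inter> space M |A. A \<in> sets N}"
  have F: "indep_sets ?F UNIV" using ind unfolding indep_vars_def2 by blast
  show "indep_sets (\<lambda>i. ?F (h i)) UNIV"
  proof (rule indep_setsI)
    show "?F (h i) \<subseteq> events" for i
      using F unfolding indep_sets_def by blast
    fix A J assume J: "J \<noteq> {}" "finite J" and A: "\<forall>j\<in>J. A j \<in> ?F (h j)"
    define A' where "A' p = A (inv h p)" for p
    have A': "A' (h j) = A j" for j using h by (simp add: A'_def)
    have "prob (\<Inter>p\<in>h ` J. A' p) = (\<Prod>p\<in>h ` J. prob (A' p))"
      by (rule indep_setsD[OF F]) (use J A A' in auto)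
    then show "prob (\<Inter>j\<in>J. A j) = (\<Prod>j\<in>J. prob (A j))"
      by (simp add: A' prod.reindex[OF inj_on_subset[OF h]])
  qed
qed

section \<open>The signature of a random sign perturbation\<close>

lemma square_integrable_dilate:
  assumes \<kappa>: "schwartz \<kappa>" and a: "a > 0"
  shows "square_integrable (dilate \<kappa> a b)"
proof -
  note K = schwartz_imp_continuous_bounded_integrable[OF \<kappa>]
  obtain B where B: "\<And>x. cmod (\<kappa> x) \<le> B" using K(2) by auto
  have cont: "continuous_on UNIV (\<lambda>y. \<kappa> ((y - b) / a))" and int: "integrable lborel (\<lambda>y. \<kappa> ((y - b) / a))"
    by (rule affine_continuous_bounded_integrable[OF a K(1,3)])+
  have "integrable lebesgue (\<lambda>y. \<kappa> ((y - b) / a))"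
    using int borel_measurable_continuous_onI[OF cont] by (subst integrable_completion) auto
  then have "square_integrable (\<lambda>y. \<kappa> ((y - b) / a))"
    by (rule square_integrable_of_bounded_integrable) (rule B)
  then show ?thesis
    unfolding dilate_def by (rule square_integrable_scale)
qed

text \<open>Bounded factors preserve the square-summability of the coefficients, so the choice in the
  definition of \<open>sign_perturbation\<close> does select an $L^2$-limit of the series; pairing with a
  square-integrable function is continuous and can be carried out term by term.\<close>

lemma has_sum_pairing_sign_perturbation:
  assumes basis: "orthonormal_wavelet_basis \<psi>" and f: "square_integrable f"
    and e: "\<And>p. \<bar>e p\<bar> \<le> 1" and \<phi>: "square_integrable \<phi>"
  shows "((\<lambda>p. of_real (e p) * (L2_inner f (wavelet \<psi> p) * pairing (wavelet \<psi> p) \<phi>))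
           has_sum pairing (sign_perturbation \<psi> e f) \<phi>) UNIV"
proof -
  interpret orthonormal_system "wavelet \<psi>"
    using basis unfolding orthonormal_wavelet_basis_def orthonormal_basis_L2_def
    by unfold_locales blast+
  have "(\<Sum>p\<in>S. (cmod (of_real (e p) * L2_inner f (wavelet \<psi> p)))\<^sup>2) \<le> (L2_norm f)\<^sup>2" if "finite S" for S
  proof -
    have "(\<Sum>p\<in>S. (cmod (of_real (e p) * L2_inner f (wavelet \<psi> p)))\<^sup>2) \<le> (\<Sum>p\<in>S. (cmod (L2_inner f (wavelet \<psi> p)))\<^sup>2)"
      using e by (intro sum_mono power_mono) (auto simp: norm_mult intro: mult_left_le_one_le)
    also have "\<dots> \<le> (L2_norm f)\<^sup>2" by (rule Bessel_inequality[OF f that])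
    finally show ?thesis .
  qed
  then have "tendsto_L2 (\<lambda>S x. \<Sum>p\<in>S. of_real (e p) * L2_inner f (wavelet \<psi> p) * wavelet \<psi> p x)
      (sign_perturbation \<psi> e f) (finite_subsets_at_top UNIV)"
    unfolding sign_perturbation_def by (rule someI_ex[OF square_summable_imp_tendsto_L2])
  from tendsto_pairing_of_tendsto_L2[OF this \<phi>] show ?thesis
    unfolding has_sum_def pairing_sum_left[OF square_integrable \<phi>] by (simp add: mult.assoc)
qed

theorem theorem6p2:
  fixes \<kappa> \<psi> :: "real \<Rightarrow> complex"
    and f :: "real \<Rightarrow> real"
    and b :: real
    and M :: "'w measure"
    and \<epsilon> :: "int \<times> int \<Rightarrow> 'w \<Rightarrow> real"
  assumes "signature_wavelet \<kappa>"
    and "orthonormal_wavelet_basis \<psi>"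
    and "\<exists>\<psi>hat. has_L2_fourier \<psi> \<psi>hat \<and> compact (ess_support \<psi>hat)"
    and "square_integrable (\<lambda>x. complex_of_real (f x))"
    and "rademacher M \<epsilon>"
  shows "AE w in M.
    signature \<kappa> (sign_perturbation \<psi> (\<lambda>p. \<epsilon> p w) (\<lambda>x. complex_of_real (f x))) b = 0"
proof -
  interpret prob_space M
    using assms(5) unfolding rademacher_def by simp
  have ind: "indep_vars (\<lambda>_. borel) \<epsilon> UNIV"
    using assms(5) unfolding rademacher_def by simp
  then have rv: "\<And>p. random_variable borel (\<epsilon> p)"
    unfolding indep_vars_def2 by blast
  have pm1: "AE w in M. \<epsilon> p w \<in> {1, - 1}"
    and sym: "distr M borel (\<lambda>w. - \<epsilon> p w) = distr M borel (\<epsilon> p)" for p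
    using rademacher_symmetric[OF rv, of p] assms(5) unfolding rademacher_def by auto
  obtain \<psi>hat where \<psi>hat: "has_L2_fourier \<psi> \<psi>hat" "compact (ess_support \<psi>hat)"
    using assms(3) by blast
  have schwartz: "schwartz \<kappa>" using assms(1) unfolding signature_wavelet_def by simp
  \<comment> \<open>Being itself a member of the basis, \<open>\<psi>\<close> is square-integrable.\<close>
  have "wavelet \<psi> (0, 0) = \<psi>" by (simp add: wavelet_def fun_eq_iff)
  then have \<psi>: "square_integrable \<psi>"
    using assms(2) unfolding orthonormal_wavelet_basis_def orthonormal_basis_L2_def by metis
  define F where "F x = complex_of_real (f x)" for x
  have F: "square_integrable F" using assms(4) unfolding F_def .
  define a :: "nat \<Rightarrow> real" where "a n = 1 / real (Suc n)" for n
  have a_pos: "a n > 0" for n by (simp add: a_def)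
  have "a \<longlonglongrightarrow> 0" unfolding a_def by (rule LIMSEQ_Suc[OF lim_1_over_n])
  then have a_lim: "filterlim a (at_right 0) sequentially"
    using a_pos by (intro tendsto_imp_filterlim_at_right) auto
  \<comment> \<open>Tail events refer to a sequence of variables, so the index pairs are enumerated.\<close>
  obtain h :: "nat \<Rightarrow> int \<times> int" where h: "bij h"
  proof
    have "infinite (UNIV :: (int \<times> int) set)"
      by (metis UNIV_Times_UNIV UNIV_not_empty finite_cartesian_productD1 infinite_UNIV_int)
    then show "bij (from_nat_into (UNIV :: (int \<times> int) set))"
      by (intro bij_betw_from_nat_into) auto
  qed
  define d where "d n i = L2_inner F (wavelet \<psi> (h i)) * pairing (wavelet \<psi> (h i)) (dilate \<kappa> (a n) b)" for n i
  have "AE w in M. \<forall>x l. (\<forall>n. (\<lambda>i. of_real (\<epsilon> (h i) w) * d n i) sums x n) \<longrightarrow>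
           (\<lambda>n. sgn (x n)) \<longlonglongrightarrow> l \<longrightarrow> l = 0"
  proof (rule sgn_random_series_no_nonzero_limit)
    show "indep_vars (\<lambda>_. borel) (\<lambda>i. \<epsilon> (h i)) UNIV"
      using h by (rule indep_vars_reindex_inj[OF ind bij_is_inj])
    show "distr M borel (\<lambda>w. - \<epsilon> (h i) w) = distr M borel (\<epsilon> (h i))" for i by (rule sym)
    show "\<forall>\<^sub>F n in sequentially. d n i = 0" for i
      using eventually_compose_filterlim[OF
          eventually_pairing_wavelet_dilate_eq_0[OF \<psi> \<psi>hat assms(1), of "h i" b] a_lim]
      by eventually_elim (simp add: d_def)
  qed
  moreover have "AE w in M. \<forall>p. \<epsilon> p w \<in> {1, - 1}"
    using pm1 by (simp add: AE_all_countable)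
  ultimately have "AE w in M. signature \<kappa> (sign_perturbation \<psi> (\<lambda>p. \<epsilon> p w) F) b = 0"
  proof eventually_elim
    case (elim w)
    let ?A = "sign_perturbation \<psi> (\<lambda>p. \<epsilon> p w) F"
    let ?s = "\<lambda>t. sgn (pairing ?A (dilate \<kappa> t b))"
    have sums: "(\<lambda>i. of_real (\<epsilon> (h i) w) * d n i) sums pairing ?A (dilate \<kappa> (a n) b)" for n
    proof -
      have "((\<lambda>p. of_real (\<epsilon> p w) * (L2_inner F (wavelet \<psi> p) * pairing (wavelet \<psi> p) (dilate \<kappa> (a n) b)))
          has_sum pairing ?A (dilate \<kappa> (a n) b)) UNIV"
      proof (rule has_sum_pairing_sign_perturbation[OF assms(2) F _ square_integrable_dilate[OF schwartz a_pos]])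
        show "\<bar>\<epsilon> p w\<bar> \<le> 1" for p using elim(2)[rule_format, of p] by auto
      qed
      then have "((\<lambda>i. of_real (\<epsilon> (h i) w) * d n i) has_sum pairing ?A (dilate \<kappa> (a n) b)) UNIV"
        unfolding d_def
        using has_sum_reindex_bij_betw[OF h, of "\<lambda>p. of_real (\<epsilon> p w) * (L2_inner F (wavelet \<psi> p) * pairing (wavelet \<psi> p) (dilate \<kappa> (a n) b))"]
        by simp
      then show ?thesis by (rule has_sum_imp_sums)
    qed
    have zero: "l = 0" if "(?s \<longlongrightarrow> l) (at_right 0)" for l
    proof -
      have "(\<lambda>n. ?s (a n)) \<longlonglongrightarrow> l" by (rule filterlim_compose[OF that a_lim])
      then show ?thesis using elim(1)[rule_format, of "\<lambda>n. pairing ?A (dilate \<kappa> (a n) b)" l] sums by simp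
    qed
    show ?case
    proof (cases "\<exists>l. (?s \<longlongrightarrow> l) (at_right 0)")
      case True
      then obtain l where l: "(?s \<longlongrightarrow> l) (at_right 0)" by blast
      have "Lim (at_right 0) ?s = l" by (rule tendsto_Lim[OF _ l]) simp
      with zero[OF l] show ?thesis unfolding signature_def Let_def by simp
    next
      case False
      then show ?thesis unfolding signature_def Let_def by simp
    qed
  qed
  then show ?thesis unfolding F_def .
qed

end
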